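(* Let $A\subset\mathbb{R}^d$ be a set with positive reach and $\dim(A)=k\ge 1$. Then: (i) $A^{(k-1)}$ is closed, and (ii) $A^{(k-1)}$ can be locally covered by finitely many DC surfaces of dimension $k-1$. Moreover, if $k>1$, $\operatorname{reach}A>r>0$ and $a\in A$, then the set $A^{(k-1)}\cap B(a,r/2)$ can be covered by a finite number $N$ of $(k-1)$-dimensional DC surfaces, where $N=N(d,k)$ depends only on $d$ and $k$.
   Context: For nonempty $A\subset\mathbb{R}^d$, $\operatorname{Unp}A$ is the set of all $z\in\mathbb{R}^d$ for which there is exactly one $a\in A$ with $|z-a|=\operatorname{dist}(z,A)$. For $a\in A$, $\operatorname{reach}(A,a):=\sup\{r\ge 0: B(a,r)\subset\operatorname{Unp}A\}$, where $B(a,r)$ is the open ball and $B(a,0):=\emptyset$; $\operatorname{reach}A:=\inf_{a\in A}\operatorname{reach}(A,a)$. $A$ has positive reach if $\operatorname{reach}A>0$. $\dim A$ is the topological dimension. $\operatorname{Tan}(A,a)$ is the set of all $u$ such that $u=0$ or there are $a\ne a_i\in A$, $r_i>0$ with $a_i\to a$ and $r_i(a_i-a)\to u$; $\operatorname{Nor}(A,a):=\{u\in\mathbb{R}^d:\langle u,v\rangle\le 0\ \text{for all } v\in\operatorname{Tan}(A,a)\}$. For $0\le j\le d$, $A^{(j)}:=\{a\in A:\dim\operatorname{Nor}(A,a)\ge d-j\}$ (dimension of a convex cone = dimension of its linear span). A real function on an open convex set is DC if it is a difference of two continuous convex functions; a mapping $F$ into a finite-dimensional space $Y$ is DC if $y^*\circ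 F$ is DC for every $y^*\in Y^*$. A DC surface of dimension $j$ ($0<j<d$) in $\mathbb{R}^d$ is a set $\{w+\varphi(w): w\in W\}$, where $W\subset\mathbb{R}^d$ is a $j$-dimensional linear subspace and $\varphi:W\to W^\perp$ is a Lipschitz DC mapping; a DC surface of dimension $0$ is a singleton. A set $M \subset A$ is locally covered by finitely many surfaces of some kind if each point of $A$ has a neighbourhood $U$ such that $M\cap U$ is contained in a union of finitely many such surfaces. *)

theory Defs
  imports "HOL-Analysis.Analysis"
begin

subsection \<open>Topological dimension\<close>

text \<open>The relation \<open>dim_le\<close> is the small inductive dimension, with the empty space of
  dimension \<open>-1\<close>; on separable metric spaces it coincides with the other usual notions of
  topological dimension.\<close>

definition has_topological_dim :: "'a::topological_space set \<Rightarrow> int \<Rightarrow> bool" where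
  "has_topological_dim A n \<longleftrightarrow> top_of_set A dim_le n \<and> \<not> top_of_set A dim_le (n - 1)"

subsection \<open>Reach\<close>

definition Unp :: "'a::euclidean_space set \<Rightarrow> 'a set" where
  "Unp A = {z. \<exists>!a. a \<in> A \<and> dist z a = infdist z A}"

definition reach_at :: "'a::euclidean_space set \<Rightarrow> 'a \<Rightarrow> ereal" where
  "reach_at A a = Sup {ereal r |r. 0 \<le> r \<and> ball a r \<subseteq> Unp A}"

definition reach :: "'a::euclidean_space set \<Rightarrow> ereal" where
  "reach A = (INF a\<in>A. reach_at A a)"

definition positive_reach :: "'a::euclidean_space set \<Rightarrow> bool" where
  "positive_reach A \<longleftrightarrow> A \<noteq> {} \<and> 0 < reach A"

subsection \<open>Tangent and normal cones\<close>

definition Tan :: "'a::euclidean_space set \<Rightarrow> 'a \<Rightarrow> 'a set" where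
  "Tan A a = {u. u = 0 \<or>
     (\<exists>(x :: nat \<Rightarrow> 'a) (r :: nat \<Rightarrow> real).
        (\<forall>i. x i \<in> A \<and> x i \<noteq> a \<and> 0 < r i) \<and>
        x \<longlonglongrightarrow> a \<and> (\<lambda>i. r i *\<^sub>R (x i - a)) \<longlonglongrightarrow> u)}"

definition Nor :: "'a::euclidean_space set \<Rightarrow> 'a \<Rightarrow> 'a set" where
  "Nor A a = {u. \<forall>v\<in>Tan A a. u \<bullet> v \<le> 0}"

text \<open>\<open>stratum A j\<close> is the set \<open>A\<^bsup>(j)\<^esup>\<close>; the constant \<open>dim\<close> is the dimension of the linear span.\<close>

definition stratum :: "'a::euclidean_space set \<Rightarrow> nat \<Rightarrow> 'a set" where
  "stratum A j = {a \<in> A. DIM('a) - j \<le> dim (Nor A a)}"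

subsection \<open>DC functions, mappings and surfaces\<close>

definition dc_on :: "'a::real_normed_vector set \<Rightarrow> ('a \<Rightarrow> real) \<Rightarrow> bool" where
  "dc_on S f \<longleftrightarrow>
    (\<exists>g h. continuous_on S g \<and> convex_on S g \<and> continuous_on S h \<and> convex_on S h \<and>
           (\<forall>x\<in>S. f x = g x - h x))"

text \<open>For a mapping with values in a linear subspace \<open>Y\<close> of the codomain type, quantifying over
  the functionals of the whole type is the same as quantifying over the dual of \<open>Y\<close>, since these
  are exactly the restrictions to \<open>Y\<close>.\<close>

definition dc_map_on :: "'a::real_normed_vector set \<Rightarrow> ('a \<Rightarrow> 'b::euclidean_space) \<Rightarrow> bool" where
  "dc_map_on S F \<longleftrightarrow> (\<forall>l :: 'b \<Rightarrow> real. linear l \<longrightarrow> dc_on S (l \<circ> F))"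

definition dc_surface :: "nat \<Rightarrow> 'a::euclidean_space set \<Rightarrow> bool" where
  "dc_surface j M \<longleftrightarrow>
    (if j = 0 then \<exists>x. M = {x}
     else j < DIM('a) \<and>
       (\<exists>W \<phi>. subspace W \<and> dim W = j \<and> \<phi> \<in> W \<rightarrow> orthogonal_comp W \<and>
              (\<exists>L. L-lipschitz_on W \<phi>) \<and> dc_map_on W \<phi> \<and>
              M = {w + \<phi> w |w. w \<in> W}))"

definition locally_finitely_covered ::
    "('a::topological_space set \<Rightarrow> bool) \<Rightarrow> 'a set \<Rightarrow> 'a set \<Rightarrow> bool" where
  "locally_finitely_covered P A M \<longleftrightarrow>
    (\<forall>a\<in>A. \<exists>U. open U \<and> a \<in> U \<and>
       (\<exists>\<S>. finite \<S> \<and> (\<forall>S\<in>\<S>. P S) \<and> M \<inter> U \<subseteq> \<Union>\<S>))"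

end

theory Submission
  imports Defs
begin

text \<open>A compact set of small inductive dimension less than \<open>m\<close> has only unstable values: a nowhere
  vanishing map from a closed subset to \<open>\<real>\<^sup>m\<close> extends without zeros. The property is visibly
  inherited by finite unions, which replaces the sum theorem of dimension theory.
  If \<open>A\<close> has positive reach, a disc in the span of \<open>Tan A a\<close> is mapped by the metric projection into
  \<open>A\<close> with a displacement small against its radius, so Brouwer's theorem gives
  \<open>dim (Tan A a) \<le> k\<close>. Hence at a point \<open>a\<close> of the stratum, \<open>Nor A a\<close>, which contains the orthogonal
  complement of \<open>Tan A a\<close>, contains a half-space of dimension \<open>d - k + 1\<close>. Half-spaces survive limits
  because \<open>Nor\<close> has closed graph, so the stratum is closed. For the covering, group the points of the
  stratum in a small ball into finitely many classes with nearly equal orthonormal frames. Each class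
  is a Lipschitz graph over the orthogonal complement \<open>W\<close> of a fixed frame, and the basis of the
  complement of \<open>W\<close> can be chosen inside all the projected half-spaces; Federer's inequality
  \<open>n \<bullet> (b - a) \<le> norm n * (norm (b - a))\<^sup>2 / (2 * r)\<close> then makes every coordinate of the graph
  semiconcave.\<close>

subsection \<open>Small inductive dimension\<close>

text \<open>The projected disc is only a perturbed, possibly non-injective image of a disc, so its
  dimension cannot be read off from an embedding; the extension property of maps still detects it.
  The covering is scale free: frames consist of unit vectors, and positions enter only as multiples
  of r. With q = d - k + 1, a net of the unit ball at scale 1/(16q) labels all classes, which is how
  the bound comes to depend on d and k alone. The factor 1/q pays for sums over the q frame vectors.
  A reference vector m_i need not be the projection of a normal at a neighbouring point. The vectors
  m_0 and m_0 + m_i, in contrast, keep a definite distance from the boundary of every slightly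
  tilted half-space. Their coordinate functions are semiconcave, and the original coordinates are
  recovered as differences, hence as DC functions.\<close>

lemma relative_frontier_subset:
  fixes S :: "'a::topological_space set"
  shows "top_of_set S frontier_of (S \<inter> U) \<subseteq> S \<inter> (closure U - interior U)"
proof -
  have "S \<inter> top_of_set S frontier_of U \<subseteq> euclidean frontier_of U"
    by (rule frontier_of_subtopology_subset)
  moreover have "top_of_set S frontier_of (S \<inter> U) = top_of_set S frontier_of U"
    by (metis frontier_of_restrict topspace_euclidean_subtopology)
  moreover have "top_of_set S frontier_of U \<subseteq> S"
    using frontier_of_subset_topspace[of "top_of_set S" U] by simp
  ultimately show ?thesis
    by (auto simp: frontier_of_def)
qed

lemma exists_between_avoiding_finite:
  fixes a b :: real
  assumes "a < b" "finite F"
  obtains c where "a < c" "c < b" "c \<notin> F"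
proof -
  have "infinite {a<..<b}" using assms by simp
  then obtain c where "c \<in> {a<..<b} - F" using assms(2)
    by (metis Diff_eq_empty_iff finite_subset ex_in_conv)
  then show ?thesis using that by auto
qed

text \<open>A pair \<open>(I, f)\<close> stands for the flat on which the coordinates in
  \<open>I\<close> agree with those of \<open>f\<close>. Every point has small boxes whose face
  values differ from the finitely many values occurring in \<open>F\<close>. A face then fixes a
  coordinate that the flat left free, so the frontier lies in flats with one more fixed coordinate.
  For \<open>j = 0\<close> more than d coordinates would be fixed, which leaves only the empty
  set.\<close>

lemma dim_le_of_subset_flats:
  fixes S :: "'a::euclidean_space set" and F :: "('a set \<times> 'a) set"
  assumes "finite F"
    and "\<And>I f. (I, f) \<in> F \<Longrightarrow> I \<subseteq> Basis \<and> m \<le> card I"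
    and "\<And>y. y \<in> S \<Longrightarrow> \<exists>(I, f)\<in>F. \<forall>i\<in>I. y \<bullet> i = f \<bullet> i"
    and "m + j = DIM('a) + 1"
  shows "top_of_set S dim_le (int j - 1)"
  using assms
proof (induction j arbitrary: S F m)
  case 0
  have False if y: "y \<in> S" for y
  proof -
    obtain I f where If: "(I, f) \<in> F" using 0(3)[OF y] by auto
    then have "I \<subseteq> Basis" "m \<le> card I" using 0(2) by auto
    moreover have "card I \<le> DIM('a)" using \<open>I \<subseteq> Basis\<close> by (simp add: card_mono)
    ultimately show False using 0(4) by simp
  qed
  then have "S = {}" by auto
  then show ?case by simp
next
  case (Suc j)
  have "\<exists>U. a \<in> U \<and> U \<subseteq> V \<and> openin euclidean U \<and>
          subtopology euclidean (top_of_set S frontier_of (S \<inter> U)) dim_le (int (Suc j) - 1 - 1)"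
    if V: "openin euclidean V" "a \<in> V" "a \<in> S" for V a
  proof -
    obtain \<alpha> \<beta> where ab: "cbox \<alpha> \<beta> \<subseteq> V" "a \<in> box \<alpha> \<beta>"
      using open_contains_cbox[of V a] V by (metis open_openin)
    have "\<exists>c. \<alpha> \<bullet> i < c \<and> c < a \<bullet> i \<and> c \<notin> (\<lambda>p. snd p \<bullet> i) ` F" if "i \<in> Basis" for i
      using exists_between_avoiding_finite[of "\<alpha> \<bullet> i" "a \<bullet> i" "(\<lambda>p. snd p \<bullet> i) ` F"] ab that Suc(2)
      by (metis finite_imageI mem_box(1))
    then obtain lo where lo: "\<And>i. i \<in> Basis \<Longrightarrow> \<alpha> \<bullet> i < lo i \<and> lo i < a \<bullet> i \<and> lo i \<notin> (\<lambda>p. snd p \<bullet> i) ` F"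
      by metis
    have "\<exists>c. a \<bullet> i < c \<and> c < \<beta> \<bullet> i \<and> c \<notin> (\<lambda>p. snd p \<bullet> i) ` F" if "i \<in> Basis" for i
      using exists_between_avoiding_finite[of "a \<bullet> i" "\<beta> \<bullet> i" "(\<lambda>p. snd p \<bullet> i) ` F"] ab that Suc(2)
      by (metis finite_imageI mem_box(1))
    then obtain hi where hi: "\<And>i. i \<in> Basis \<Longrightarrow> a \<bullet> i < hi i \<and> hi i < \<beta> \<bullet> i \<and> hi i \<notin> (\<lambda>p. snd p \<bullet> i) ` F"
      by metis
    define l where "l = (\<Sum>i\<in>Basis. lo i *\<^sub>R i)"
    define u where "u = (\<Sum>i\<in>Basis. hi i *\<^sub>R i)"
    have l: "l \<bullet> i = lo i" and u: "u \<bullet> i = hi i" if "i \<in> Basis" for i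
      using that by (simp_all add: l_def u_def)
    have aU: "a \<in> box l u" using lo hi l u by (simp add: mem_box)
    have "box l u \<subseteq> cbox \<alpha> \<beta>"
    proof
      fix y assume y: "y \<in> box l u"
      have "\<alpha> \<bullet> i \<le> y \<bullet> i \<and> y \<bullet> i \<le> \<beta> \<bullet> i" if "i \<in> Basis" for i
        using y lo[OF that] hi[OF that] l[OF that] u[OF that] that unfolding mem_box by force
      then show "y \<in> cbox \<alpha> \<beta>" by (simp add: mem_box)
    qed
    then have UV: "box l u \<subseteq> V" using ab by auto
    define F' where "F' = (\<lambda>((I, f), i, c). (insert i I, f + (c \<bullet> i - f \<bullet> i) *\<^sub>R i)) `
       {((I, f), i, c). (I, f) \<in> F \<and> i \<in> Basis \<and> c \<in> {l, u} \<and> i \<notin> I}"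
    have "{((I, f), i, c). (I, f) \<in> F \<and> i \<in> Basis \<and> c \<in> {l, u} \<and> i \<notin> I} \<subseteq> F \<times> Basis \<times> {l, u}"
      by auto
    then have fin: "finite F'" unfolding F'_def
      using Suc(2) by (intro finite_imageI) (meson finite_Basis finite.intros finite_SigmaI finite_subset)
    have "top_of_set (top_of_set S frontier_of (S \<inter> box l u)) dim_le (int j - 1)"
    proof (rule Suc.IH[OF fin])
      show "I \<subseteq> Basis \<and> Suc m \<le> card I" if If: "(I, f) \<in> F'" for I f
      proof -
        obtain I' f' i where *: "I = insert i I'" "i \<in> Basis" "i \<notin> I'" "(I', f') \<in> F"
          using If unfolding F'_def by auto
        then have "I' \<subseteq> Basis" "m \<le> card I'" using Suc(3) by auto
        then show ?thesis using * finite_subset[OF _ finite_Basis, of I'] by auto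
      qed
      show "\<exists>(I, f)\<in>F'. \<forall>i\<in>I. y \<bullet> i = f \<bullet> i" if y: "y \<in> top_of_set S frontier_of (S \<inter> box l u)" for y
      proof -
        have "y \<in> S" "y \<in> closure (box l u)" "y \<notin> box l u"
          using y relative_frontier_subset[of S "box l u"] by (auto simp: interior_open open_box)
        moreover have "closure (box l u) \<subseteq> cbox l u"
          by (intro closure_minimal box_subset_cbox closed_cbox)
        ultimately have "y \<in> cbox l u" by blast
        with \<open>y \<notin> box l u\<close> obtain i c where i: "i \<in> Basis" "c \<in> {l, u}" "y \<bullet> i = c \<bullet> i"
          unfolding mem_box by (metis insertCI order_le_less)
        obtain I f where If: "(I, f) \<in> F" "\<forall>i\<in>I. y \<bullet> i = f \<bullet> i"
          using Suc(4)[OF \<open>y \<in> S\<close>] by auto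
        have "c \<bullet> i \<notin> (\<lambda>p. snd p \<bullet> i) ` F" using i(2) lo[OF i(1)] hi[OF i(1)] l[OF i(1)] u[OF i(1)] by (metis insertE singletonD)
        then have "i \<notin> I" using If i by (metis image_eqI snd_conv)
        have IB: "I \<subseteq> Basis" using Suc(3) If by auto
        have "(insert i I, f + (c \<bullet> i - f \<bullet> i) *\<^sub>R i) \<in> F'"
          unfolding F'_def using If i \<open>i \<notin> I\<close> by force
        moreover have "\<forall>i'\<in>insert i I. y \<bullet> i' = (f + (c \<bullet> i - f \<bullet> i) *\<^sub>R i) \<bullet> i'"
          using If i \<open>i \<notin> I\<close> IB by (auto simp: inner_add_left inner_Basis)
        ultimately show ?thesis
          by (intro bexI[where x = "(insert i I, f + (c \<bullet> i - f \<bullet> i) *\<^sub>R i)"]) (simp_all only: prod.case)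
      qed
      show "Suc m + j = DIM('a) + 1" using Suc.prems(4) by simp
    qed
    then show ?thesis using aU UV by (intro exI[of _ "box l u"]) (simp add: open_box)
  qed
  then show ?case by (subst dimension_le_eq_subtopology) auto
qed

lemma dim_le_DIM:
  fixes S :: "'a::euclidean_space set"
  shows "top_of_set S dim_le int (DIM('a))"
  using dim_le_of_subset_flats[of "{({}, 0)}" 0 S "DIM('a) + 1"] by simp

section \<open>Zero-free extension of maps and inductive dimension\<close>

text \<open>Maps into \<real>^m are given by m coordinate functions because m varies in the
  induction. They are continuous on the whole space, so no extension theorem has to be invoked at
  each step. The compact set \<open>C\<close> is not confined to \<open>X\<close>; this freedom
  makes finite unions work.\<close>

definition unstable_values :: "nat \<Rightarrow> 'a::euclidean_space set \<Rightarrow> bool" where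
  "unstable_values m X \<longleftrightarrow> (\<forall>C (f :: nat \<Rightarrow> 'a \<Rightarrow> real).
     compact C \<and> (\<forall>i<m. continuous_on UNIV (f i)) \<and> (\<forall>x\<in>C. \<exists>i<m. f i x \<noteq> 0) \<longrightarrow>
     (\<exists>g. (\<forall>i<m. continuous_on UNIV (g i)) \<and> (\<forall>i<m. \<forall>x\<in>C. g i x = f i x) \<and>
          (\<forall>x\<in>C \<union> X. \<exists>i<m. g i x \<noteq> 0)))"

text \<open>Once the map has been extended over \<open>X\<close>, the set
  \<open>C \<union> X\<close> takes over the role of the set on which values are prescribed.\<close>

lemma unstable_values_Un:
  assumes "unstable_values m X" "unstable_values m Y" "compact X"
  shows "unstable_values m (X \<union> Y)"
  unfolding unstable_values_def
proof (intro allI impI, elim conjE)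
  fix C and f :: "nat \<Rightarrow> 'a \<Rightarrow> real"
  assume C: "compact C" and f: "\<forall>i<m. continuous_on UNIV (f i)" "\<forall>x\<in>C. \<exists>i<m. f i x \<noteq> 0"
  obtain g where g: "\<forall>i<m. continuous_on UNIV (g i)" "\<forall>i<m. \<forall>x\<in>C. g i x = f i x"
     "\<forall>x\<in>C \<union> X. \<exists>i<m. g i x \<noteq> 0"
    using assms(1)[unfolded unstable_values_def, rule_format, of C f] C f by blast
  have "compact (C \<union> X)" using C assms(3) by auto
  then obtain h where h: "\<forall>i<m. continuous_on UNIV (h i)" "\<forall>i<m. \<forall>x\<in>C \<union> X. h i x = g i x"
     "\<forall>x\<in>(C \<union> X) \<union> Y. \<exists>i<m. h i x \<noteq> 0"
    using assms(2)[unfolded unstable_values_def, rule_format, of "C \<union> X" g] g(1,3) by blast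
  show "\<exists>g. (\<forall>i<m. continuous_on UNIV (g i)) \<and> (\<forall>i<m. \<forall>x\<in>C. g i x = f i x) \<and>
          (\<forall>x\<in>C \<union> (X \<union> Y). \<exists>i<m. g i x \<noteq> 0)"
    using g(2) h by (intro exI[of _ h]) (auto simp: Un_assoc)
qed

lemma unstable_values_empty: "unstable_values m {}"
  unfolding unstable_values_def by auto

lemma unstable_values_UN:
  assumes "finite T" "\<And>t. t \<in> T \<Longrightarrow> compact (X t) \<and> unstable_values m (X t)"
  shows "unstable_values m (\<Union>t\<in>T. X t)"
  using assms
  by (induction T rule: finite_induct) (auto intro!: unstable_values_empty unstable_values_Un)

text \<open>On \<open>C\<close> it suffices to match the sign of one nonzero coordinate at each
  point. A Urysohn function blends \<open>f\<close> into \<open>g\<close>: on \<open>V\<close> the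
  convex combination keeps the common sign of some coordinate, and off \<open>V\<close> it equals
  \<open>g\<close>.\<close>

lemma zero_free_extension_of_same_sign:
  fixes f g :: "nat \<Rightarrow> 'a::euclidean_space \<Rightarrow> real"
  assumes "compact C" "\<And>i. i < m \<Longrightarrow> continuous_on UNIV (f i)" "\<And>i. i < m \<Longrightarrow> continuous_on UNIV (g i)"
    and C: "\<And>x. x \<in> C \<Longrightarrow> \<exists>i<m. 0 < f i x * g i x"
    and X: "\<And>x. x \<in> X \<Longrightarrow> \<exists>i<m. g i x \<noteq> 0"
  shows "\<exists>h. (\<forall>i<m. continuous_on UNIV (h i)) \<and> (\<forall>i<m. \<forall>x\<in>C. h i x = f i x) \<and>
          (\<forall>x\<in>C \<union> X. \<exists>i<m. h i x \<noteq> 0)"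
proof -
  define V where "V = (\<Union>i<m. {x. 0 < f i x * g i x})"
  have "open V" unfolding V_def
    using assms(2,3) by (intro open_UN ballI open_Collect_less continuous_intros) auto
  have "C \<subseteq> V" using C by (auto simp: V_def)
  obtain w :: "'a \<Rightarrow> real" where w: "continuous_on UNIV w" "\<And>x. w x \<in> closed_segment 0 1"
     "\<And>x. x \<in> C \<Longrightarrow> w x = 0" "\<And>x. x \<in> - V \<Longrightarrow> w x = 1"
    using Urysohn[of C "- V" 0 1] assms(1) \<open>open V\<close> \<open>C \<subseteq> V\<close> compact_imp_closed by blast
  have w01: "0 \<le> w x" "w x \<le> 1" for x using w(2)[of x] by (auto simp: closed_segment_eq_real_ivl)
  define h where "h = (\<lambda>i x. (1 - w x) * f i x + w x * g i x)"
  have "\<exists>i<m. h i x \<noteq> 0" if "x \<in> C \<union> X" for x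
  proof (cases "x \<in> V")
    case True
    then obtain i where i: "i < m" "0 < f i x * g i x" by (auto simp: V_def)
    have "0 < f i x * f i x" using i by (metis mult_zero_left not_real_square_gt_zero order_less_irrefl)
    have "h i x * f i x = (1 - w x) * (f i x * f i x) + w x * (f i x * g i x)"
      by (simp add: h_def algebra_simps)
    also have "\<dots> > 0"
    proof (cases "w x = 0")
      case False
      then show ?thesis using i w01[of x] \<open>0 < f i x * f i x\<close>
        by (intro add_nonneg_pos) auto
    qed (use \<open>0 < f i x * f i x\<close> in auto)
    finally show ?thesis using i(1) by (metis mult_zero_left order_less_irrefl)
  next
    case False
    then have "x \<in> X" using that \<open>C \<subseteq> V\<close> by auto
    then show ?thesis using X[of x] w(4)[of x] False by (simp add: h_def)
  qed
  moreover have "\<forall>i<m. continuous_on UNIV (h i)"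
    unfolding h_def using assms(2,3) w(1) by (auto intro!: continuous_intros)
  moreover have "\<forall>i<m. \<forall>x\<in>C. h i x = f i x" using w(3) by (simp add: h_def)
  ultimately show ?thesis by blast
qed

text \<open>The difference of the distances to \<open>T\<close> and \<open>S\<close> serves when
  both are nonempty. The distance to the empty set is 0 by convention and would lose strictness, so
  constants are used there.\<close>

lemma exists_sign_function:
  fixes S T :: "'a::euclidean_space set"
  assumes "closed S" "closed T"
  obtains g :: "'a \<Rightarrow> real" where "continuous_on UNIV g"
    "\<And>x. x \<in> S - T \<Longrightarrow> 0 < g x" "\<And>x. x \<in> T - S \<Longrightarrow> g x < 0"
proof (cases "S = {} \<or> T = {}")
  case True
  then consider "S = {}" | "T = {}" by auto
  then show ?thesis
  proof cases
    case 1 then show ?thesis by (intro that[of "\<lambda>_. -1"]) auto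
  next
    case 2 then show ?thesis by (intro that[of "\<lambda>_. 1"]) auto
  qed
next
  case False
  have "0 < infdist x U" if "closed U" "U \<noteq> {}" "x \<notin> U" for x and U :: "'a set"
    using that by (simp add: infdist_pos_not_in_closed)
  then show ?thesis using False assms
    by (intro that[of "\<lambda>x. infdist x T - infdist x S"]) (auto intro!: continuous_intros)
qed

text \<open>The last coordinate \<open>u\<close> is replaced by a function \<open>s\<close> with the
  same sign wherever \<open>\<bar>u\<bar> > \<delta>\<close> on \<open>C\<close>, whose zeros in
  \<open>X\<close> all lie in a partition \<open>L\<close> made of finitely many relative frontiers.
  These have smaller dimension, so the induction hypothesis makes the other \<open>n\<close>
  coordinates zero-free on \<open>L\<close>. The two replacements never vanish simultaneously on
  \<open>X\<close>, and sign agreement on \<open>C\<close> is enough by blending.\<close>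

lemma dim_le_imp_unstable_values:
  fixes X :: "'a::euclidean_space set"
  assumes "compact X" "top_of_set X dim_le (int m - 1)"
  shows "unstable_values m X"
  using assms
proof (induction m arbitrary: X)
  case 0
  then have "top_of_set X = trivial_topology" by simp
  then have "X = {}" by (metis topspace_discrete_topology topspace_euclidean_subtopology)
  then show ?case by (simp add: unstable_values_empty)
next
  case (Suc n)
  show ?case unfolding unstable_values_def
  proof (intro allI impI, elim conjE)
    fix C and f :: "nat \<Rightarrow> 'a \<Rightarrow> real"
    assume C: "compact C" and fc: "\<forall>i<Suc n. continuous_on UNIV (f i)"
      and f0: "\<forall>x\<in>C. \<exists>i<Suc n. f i x \<noteq> 0"
    define u where "u = f n"
    have uc: "continuous_on UNIV u" using fc by (simp add: u_def)
    \<comment> \<open>On the compact set of common zeros in \<open>C\<close> of the first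
      \<open>n\<close> coordinates, \<open>u\<close> does not vanish; \<delta> is half the minimum
      of its absolute value there, or 1 if there are no such zeros.\<close>
    have "\<exists>\<delta>>0. \<forall>x\<in>C. \<bar>u x\<bar> \<le> \<delta> \<longrightarrow> (\<exists>i<n. f i x \<noteq> 0)"
    proof -
      have cl: "closed (\<Inter>i<n. {x. f i x = 0})"
        using fc by (intro closed_INT ballI closed_Collect_eq) auto
      define Z where "Z = C \<inter> (\<Inter>i<n. {x. f i x = 0})"
      have Z: "compact Z" unfolding Z_def using C cl by (simp add: compact_Int_closed)
      have un: "u x \<noteq> 0" if "x \<in> Z" for x
        using f0 that unfolding Z_def u_def by (auto simp: less_Suc_eq)
      show ?thesis
      proof (cases "Z = {}")
        case True
        then show ?thesis by (intro exI[of _ 1]) (auto simp: Z_def)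
      next
        case False
        have "continuous_on Z (\<lambda>x. \<bar>u x\<bar>)"
          using uc by (intro continuous_intros) (auto intro: continuous_on_subset)
        then obtain z where z: "z \<in> Z" "\<And>x. x \<in> Z \<Longrightarrow> \<bar>u z\<bar> \<le> \<bar>u x\<bar>"
          using continuous_attains_inf[OF Z False, of "\<lambda>x. \<bar>u x\<bar>"] by auto
        have "\<exists>i<n. f i x \<noteq> 0" if "x \<in> C" "\<bar>u x\<bar> \<le> \<bar>u z\<bar> / 2" for x
        proof (rule ccontr)
          assume "\<not> ?thesis"
          then have "x \<in> Z" using that by (auto simp: Z_def)
          then show False using z(2)[of x] that un[OF z(1)] by auto
        qed
        then show ?thesis using un[OF z(1)] by (intro exI[of _ "\<bar>u z\<bar> / 2"]) auto
      qed
    qed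
    then obtain \<delta> where \<delta>: "0 < \<delta>" "\<And>x. x \<in> C \<Longrightarrow> \<bar>u x\<bar> \<le> \<delta> \<Longrightarrow> \<exists>i<n. f i x \<noteq> 0"
      by blast
    \<comment> \<open>Points of \<open>C\<close> outside \<open>X\<close> are included so that
      \<open>s\<close> will receive the sign of \<open>u\<close> there as well.\<close>
    define P where "P = (C \<union> X) \<inter> {x. \<delta> \<le> u x}"
    define Q where "Q = (C \<union> X) \<inter> {x. u x \<le> - \<delta>}"
    have cP: "compact P" "compact Q" unfolding P_def Q_def using C Suc.prems uc
      by (auto intro!: compact_Int_closed closed_Collect_le continuous_intros)
    have op: "open {x. 0 < u x}" using uc by (intro open_Collect_less continuous_intros)
    let ?Fr = "\<lambda>U. top_of_set X frontier_of (X \<inter> U)"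
    have "\<exists>U. p \<in> U \<and> U \<subseteq> {x. 0 < u x} \<and> open U \<and> top_of_set (?Fr U) dim_le (int n - 1)"
      if "p \<in> P \<inter> X" for p
    proof -
      have "p \<in> {x. 0 < u x}" using that \<delta>(1) by (auto simp: P_def)
      moreover have "top_of_set X dim_le int n" using Suc.prems by simp
      ultimately show ?thesis
        using op that unfolding dimension_le_eq_subtopology[of euclidean X] by auto
    qed
    then obtain U where U: "\<And>p. p \<in> P \<inter> X \<Longrightarrow> p \<in> U p \<and> U p \<subseteq> {x. 0 < u x} \<and> open (U p)
        \<and> top_of_set (?Fr (U p)) dim_le (int n - 1)"
      by metis
    have "compact (P \<inter> X)" using cP Suc.prems by auto
    moreover have "P \<inter> X \<subseteq> (\<Union>p\<in>P \<inter> X. U p)" using U by blast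
    ultimately obtain T where T: "T \<subseteq> P \<inter> X" "finite T" "P \<inter> X \<subseteq> (\<Union>p\<in>T. U p)"
      using U compactE_image[of "P \<inter> X" "P \<inter> X" U] by metis
    define G where "G = (\<Union>p\<in>T. U p)"
    have oG: "open G" unfolding G_def using U T by (intro open_UN ballI) blast
    have Gu: "G \<subseteq> {x. 0 < u x}" using U T by (auto simp: G_def)
    have clX: "closed X" using Suc.prems compact_imp_closed by auto
    have cFr: "compact (?Fr V)" for V
      using closedin_compact[OF Suc.prems(1)] closedin_frontier_of by blast
    define L where "L = (\<Union>p\<in>T. ?Fr (U p))"
    have "unstable_values n L" unfolding L_def
    proof (intro unstable_values_UN conjI)
      show "finite T" by fact
      fix p assume "p \<in> T"
      then have "top_of_set (?Fr (U p)) dim_le (int n - 1)" using T U by blast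
      then show "compact (?Fr (U p))" "unstable_values n (?Fr (U p))" using cFr Suc.IH by auto
    qed
    \<comment> \<open>The positive and the negative side of the partition: together they cover
      \<open>X\<close>, and they meet only in \<open>L\<close>. Adding \<open>P\<close> and
      \<open>Q\<close> prescribes the sign of \<open>s\<close> on the part of \<open>C\<close> where
      \<open>u\<close> is large.\<close>
    define K1 where "K1 = closure (X \<inter> G) \<union> P"
    define K2 where "K2 = (X - G) \<union> Q"
    have clK: "closed K1" "closed K2" unfolding K1_def K2_def
      using cP clX oG compact_imp_closed by (auto intro!: closed_Un)
    have clG: "closure (X \<inter> G) \<subseteq> X \<inter> {x. 0 \<le> u x}"
    proof (rule closure_minimal)
      show "X \<inter> G \<subseteq> X \<inter> {x. 0 \<le> u x}" using Gu by auto
      show "closed (X \<inter> {x. 0 \<le> u x})" using clX uc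
        by (intro closed_Int closed_Collect_le continuous_intros) auto
    qed
    have PK: "P \<inter> K2 = {}" using T \<delta>(1) by (auto simp: K2_def G_def P_def Q_def)
    have QK: "Q \<inter> K1 = {}" using clG \<delta>(1) by (auto simp: K1_def P_def Q_def)
    have KL: "K1 \<inter> K2 \<subseteq> L"
    proof
      fix x assume x: "x \<in> K1 \<inter> K2"
      then have "x \<in> closure (X \<inter> G)" "x \<in> X - G"
        using PK QK unfolding K1_def K2_def by auto
      moreover have "X \<inter> G = (\<Union>p\<in>T. X \<inter> U p)" by (auto simp: G_def)
      moreover have "closure (\<Union>p\<in>T. X \<inter> U p) \<subseteq> (\<Union>p\<in>T. closure (X \<inter> U p))"
      proof (rule closure_minimal)
        show "(\<Union>p\<in>T. X \<inter> U p) \<subseteq> (\<Union>p\<in>T. closure (X \<inter> U p))"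
          by (intro UN_mono subset_refl closure_subset)
        show "closed (\<Union>p\<in>T. closure (X \<inter> U p))"
          using T(2) by (intro closed_UN ballI closed_closure)
      qed
      ultimately have "x \<in> (\<Union>p\<in>T. closure (X \<inter> U p))" by auto
      then obtain p where p: "p \<in> T" "x \<in> closure (X \<inter> U p)" by auto
      have "openin (top_of_set X) (X \<inter> U p)" using U T p by (meson openin_open_Int subsetD)
      then have "?Fr (U p) = X \<inter> closure (X \<inter> U p) - X \<inter> U p"
        by (simp add: frontier_of_def interior_of_openin closure_of_subtopology)
      then have "x \<in> ?Fr (U p)" using p \<open>x \<in> X - G\<close> by (auto simp: G_def)
      then show "x \<in> L" using p by (auto simp: L_def)
    qed
    obtain s :: "'a \<Rightarrow> real" where s: "continuous_on UNIV s"
      "\<And>x. x \<in> K1 - K2 \<Longrightarrow> 0 < s x" "\<And>x. x \<in> K2 - K1 \<Longrightarrow> s x < 0"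
      using exists_sign_function[OF clK] by blast
    \<comment> \<open>Where \<open>\<bar>u\<bar> \<le> \<delta>\<close> the first \<open>n\<close>
      coordinates are nonzero and are kept exactly; on the rest of \<open>C\<close> the sign of
      \<open>s\<close> takes care of the blending.\<close>
    define C1 where "C1 = C \<inter> {x. \<bar>u x\<bar> \<le> \<delta>}"
    have "compact C1" unfolding C1_def using C uc
      by (auto intro!: compact_Int_closed closed_Collect_le continuous_intros)
    moreover have "\<forall>i<n. continuous_on UNIV (f i)" using fc by auto
    moreover have "\<forall>x\<in>C1. \<exists>i<n. f i x \<noteq> 0" using \<delta> by (auto simp: C1_def)
    ultimately obtain g where g: "\<forall>i<n. continuous_on UNIV (g i)" "\<forall>i<n. \<forall>x\<in>C1. g i x = f i x"
     "\<forall>x\<in>C1 \<union> L. \<exists>i<n. g i x \<noteq> 0"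
      using \<open>unstable_values n L\<close>[unfolded unstable_values_def, rule_format, of C1 f] by blast
    define g' where "g' = g(n := s)"
    show "\<exists>g. (\<forall>i<Suc n. continuous_on UNIV (g i)) \<and> (\<forall>i<Suc n. \<forall>x\<in>C. g i x = f i x) \<and>
          (\<forall>x\<in>C \<union> X. \<exists>i<Suc n. g i x \<noteq> 0)"
    proof (rule zero_free_extension_of_same_sign[OF C, where g = g'])
      show "continuous_on UNIV (f i)" if "i < Suc n" for i using fc that by auto
      show "continuous_on UNIV (g' i)" if "i < Suc n" for i
        using g(1) s(1) that by (auto simp: g'_def)
      show "\<exists>i<Suc n. 0 < f i x * g' i x" if xC: "x \<in> C" for x
      proof (cases "\<bar>u x\<bar> \<le> \<delta>")
        case True
        then have "x \<in> C1" using xC by (simp add: C1_def)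
        then obtain i where "i < n" "g i x \<noteq> 0" "g i x = f i x" using g by blast
        then have "0 < f i x * g' i x" by (simp add: g'_def) (metis not_real_square_gt_zero)
        then show ?thesis using \<open>i < n\<close> less_SucI by blast
      next
        case False
        then consider "x \<in> P" | "x \<in> Q" using xC by (force simp: P_def Q_def)
        then have "0 < u x * s x"
        proof cases
          case 1
          then have "0 < s x" using s(2)[of x] PK by (auto simp: K1_def)
          then show ?thesis using 1 \<delta>(1) by (simp add: P_def)
        next
          case 2
          then have "s x < 0" using s(3)[of x] QK by (auto simp: K2_def)
          then show ?thesis using 2 \<delta>(1) by (simp add: Q_def mult_neg_neg)
        qed
        then show ?thesis by (intro exI[of _ n]) (simp add: g'_def u_def)
      qed
      show "\<exists>i<Suc n. g' i x \<noteq> 0" if "x \<in> X" for x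
      proof (cases "x \<in> L")
        case True
        then obtain i where "i < n" "g i x \<noteq> 0" using g by blast
        then show ?thesis by (intro exI[of _ i]) (simp add: g'_def)
      next
        case False
        have "x \<in> K1 \<union> K2"
          using that closure_subset[of "X \<inter> G"] by (auto simp: K1_def K2_def)
        then have "s x \<noteq> 0" using False KL s(2,3)[of x] by fastforce
        then show ?thesis by (intro exI[of _ n]) (simp add: g'_def)
      qed
    qed
  qed
qed

subsection \<open>Normal and tangent cones of sets with positive reach\<close>

lemma dist_closest_point:
  fixes A :: "'a::euclidean_space set"
  assumes "closed A" "A \<noteq> {}"
  shows "closest_point A z \<in> A" "dist z (closest_point A z) = infdist z A"
proof -
  show *: "closest_point A z \<in> A" using closest_point_in_set assms by auto
  have "infdist z A \<le> dist z (closest_point A z)" by (rule infdist_le[OF *])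
  moreover have "dist z (closest_point A z) \<le> infdist z A"
    unfolding infdist_notempty[OF assms(2)]
    using assms by (intro cINF_greatest closest_point_le) auto
  ultimately show "dist z (closest_point A z) = infdist z A" by simp
qed

lemma closest_point_eq_of_Unp:
  fixes A :: "'a::euclidean_space set"
  assumes "closed A" "z \<in> Unp A" "a \<in> A" "\<And>b. b \<in> A \<Longrightarrow> dist z a \<le> dist z b"
  shows "closest_point A z = a"
proof -
  have "A \<noteq> {}" using assms by auto
  note d = dist_closest_point[OF assms(1) this, of z]
  have "dist z a = infdist z A"
    using assms(4)[OF d(1)] d(2) infdist_le[OF assms(3), of z] by simp
  then show ?thesis using assms(2,3) d unfolding Unp_def by blast
qed

text \<open>By uniqueness the graph is the solution set of \<open>dist x y = infdist x A\<close>,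
  hence relatively closed, and a map with closed graph into a compact set is continuous. Boundedness
  of \<open>S\<close> provides the compact target: a foot point is no farther from x than the fixed
  point \<open>a\<close> is.\<close>

lemma continuous_on_closest_point_Unp:
  fixes A :: "'a::euclidean_space set"
  assumes "closed A" "A \<noteq> {}" "bounded S" "S \<subseteq> Unp A"
  shows "continuous_on S (closest_point A)"
proof -
  note d = dist_closest_point[OF assms(1,2)]
  obtain R where R: "\<And>x. x \<in> S \<Longrightarrow> norm x \<le> R" using assms(3) by (auto simp: bounded_iff)
  obtain a where a: "a \<in> A" using assms(2) by auto
  define T where "T = A \<inter> cball 0 (R + (R + norm a))"
  have "compact T" unfolding T_def using assms(1) by (simp add: closed_Int_compact)
  have T: "closest_point A x \<in> T" if "x \<in> S" for x
  proof -
    have "dist x (closest_point A x) \<le> dist x a" using d(2)[of x] infdist_le[OF a, of x] by simp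
    also have "\<dots> \<le> R + norm a" using R[OF that] norm_triangle_ineq4[of x a] by (simp add: dist_norm)
    finally have "norm (closest_point A x) \<le> R + (R + norm a)"
      using R[OF that] norm_triangle_sub[of "closest_point A x" x] by (simp add: dist_norm norm_minus_commute)
    then show ?thesis using d(1) by (simp add: T_def)
  qed
  have eq: "(\<lambda>x. (x, closest_point A x)) ` S = (S \<times> T) \<inter> {p. dist (fst p) (snd p) = infdist (fst p) A}"
  proof (intro equalityI subsetI)
    fix p assume "p \<in> (S \<times> T) \<inter> {p. dist (fst p) (snd p) = infdist (fst p) A}"
    then obtain x y where p: "p = (x, y)" "x \<in> S" "y \<in> T" "dist x y = infdist x A"
      by (cases p) auto
    then have "closest_point A x = y" using assms T_def
      by (intro closest_point_eq_of_Unp) (auto intro: infdist_le)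
    then show "p \<in> (\<lambda>x. (x, closest_point A x)) ` S" using p by auto
  qed (use T d in auto)
  have "closed {p. dist (fst p) (snd p) = infdist (fst p) A}"
    by (intro closed_Collect_eq continuous_intros)
  then have "closedin (top_of_set (S \<times> T)) ((\<lambda>x. (x, closest_point A x)) ` S)"
    unfolding eq by (rule closedin_closed_Int)
  moreover have "closest_point A \<in> S \<rightarrow> T" using T by blast
  ultimately show ?thesis
    using continuous_closed_graph_eq[OF \<open>compact T\<close>] by blast
qed

lemma proximal_inequality_limit:
  fixes x n :: "nat \<Rightarrow> 'a::euclidean_space"
  assumes "x \<longlonglongrightarrow> a" "n \<longlonglongrightarrow> m"
    and "\<And>j. n j \<bullet> (b - x j) \<le> norm (n j) * (norm (b - x j))\<^sup>2 / (2 * r)"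
  shows "m \<bullet> (b - a) \<le> norm m * (norm (b - a))\<^sup>2 / (2 * r)"
proof (rule LIMSEQ_le)
  show "(\<lambda>j. n j \<bullet> (b - x j)) \<longlonglongrightarrow> m \<bullet> (b - a)"
    by (intro tendsto_intros assms)
  have "(\<lambda>j. norm (n j) * (norm (b - x j))\<^sup>2 * inverse (2 * r)) \<longlonglongrightarrow> norm m * (norm (b - a))\<^sup>2 * inverse (2 * r)"
    by (intro tendsto_intros assms)
  then show "(\<lambda>j. norm (n j) * (norm (b - x j))\<^sup>2 / (2 * r)) \<longlonglongrightarrow> norm m * (norm (b - a))\<^sup>2 / (2 * r)"
    unfolding divide_inverse .
  show "\<exists>N. \<forall>j\<ge>N. n j \<bullet> (b - x j) \<le> norm (n j) * (norm (b - x j))\<^sup>2 / (2 * r)"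
    using assms(3) by blast
qed

text \<open>The strict inequality \<open>r < reach A\<close> puts even the closed r-neighbourhood of
  each point of \<open>A\<close> into \<open>Unp A\<close>, so that compactness arguments may use
  the value r itself.\<close>

locale reach_bound =
  fixes A :: "'a::euclidean_space set" and r :: real
  assumes r_pos: "0 < r" and r_less: "ereal r < reach A" and nonempty: "A \<noteq> {}"
begin

lemma mem_Unp_of_dist_le:
  assumes "a \<in> A" "dist z a \<le> r"
  shows "z \<in> Unp A"
proof -
  have "ereal r < reach_at A a"
    using r_less INF_lower[OF assms(1), of "reach_at A"] unfolding reach_def by (rule less_le_trans)
  then obtain s where s: "r < s" "ball a s \<subseteq> Unp A"
    unfolding reach_at_def less_Sup_iff by auto
  then show ?thesis using assms(2) by (auto simp: dist_commute subset_eq)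
qed

text \<open>A point of the closure lies in \<open>Unp A\<close>, and the nearest point, whose
  existence is part of \<open>Unp\<close>, is at distance 0.\<close>

lemma closed_A: "closed A"
proof -
  have "x \<in> A" if x: "x \<in> closure A" for x
  proof -
    obtain a where "a \<in> A" "dist a x < r" using closure_approachable[of x A] x r_pos by blast
    then have "x \<in> Unp A" by (intro mem_Unp_of_dist_le[of a]) (auto simp: dist_commute)
    moreover have "infdist x A = 0" using x in_closure_iff_infdist_zero[OF nonempty] by simp
    ultimately show ?thesis unfolding Unp_def by auto
  qed
  then show ?thesis using closure_subset_eq[of A] by blast
qed

abbreviation proj where "proj \<equiv> closest_point A"

lemmas proj_mem = dist_closest_point(1)[OF closed_A nonempty]
lemmas dist_proj = dist_closest_point(2)[OF closed_A nonempty]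

lemma mem_Unp:
  assumes "infdist z A \<le> r"
  shows "z \<in> Unp A"
  by (rule mem_Unp_of_dist_le[OF proj_mem[of z]]) (use assms dist_proj in simp)

text \<open>The reason why a normal ray stays normal up to the reach: if the foot point stayed constant
  only up to \<open>z\<close>, Brouwer's theorem would give a point \<open>y\<close> near \<open>z\<close> such that \<open>z\<close> lies between \<open>y\<close>
  and its foot point, and then \<open>y\<close> lies further out on the same ray.\<close>

lemma normal_ray_extends:
  assumes a: "a \<in> A" and n: "norm n = 1" and t: "0 < t" "t \<le> r"
    and near: "\<And>b. b \<in> A \<Longrightarrow> t \<le> dist (a + t *\<^sub>R n) b"
    and b: "b \<in> A"
  shows "r \<le> dist (a + r *\<^sub>R n) b"
proof -
  define G where "G = {0..r} \<inter> (\<Inter>b\<in>A. {s. s \<le> dist (a + s *\<^sub>R n) b})"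
  have "compact G" unfolding G_def
    by (intro compact_Int_closed compact_Icc closed_INT ballI closed_Collect_le continuous_intros)
  moreover have "t \<in> G" using near t by (auto simp: G_def)
  ultimately obtain \<tau> where \<tau>: "\<tau> \<in> G" "\<And>s. s \<in> G \<Longrightarrow> s \<le> \<tau>"
    using compact_attains_sup[of G] by auto
  have "0 < \<tau>" using \<tau>(2)[OF \<open>t \<in> G\<close>] t by simp
  have "\<tau> = r"
  proof (rule ccontr)
    assume "\<tau> \<noteq> r"
    then have "\<tau> < r" using \<tau>(1) by (auto simp: G_def)
    \<comment> \<open>The largest radius for which the triangle inequality keeps the ball about
      \<open>z\<close> within distance r of \<open>a\<close>, hence inside
      \<open>Unp A\<close>.\<close>
    define \<epsilon> where "\<epsilon> = r - \<tau>"
    have "0 < \<epsilon>" using \<open>\<tau> < r\<close> by (simp add: \<epsilon>_def)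
    define z where "z = a + \<tau> *\<^sub>R n"
    have za: "dist z a = \<tau>" using n \<open>0 < \<tau>\<close> by (simp add: z_def dist_norm)
    have zb: "\<tau> \<le> dist z b" if "b \<in> A" for b using \<tau>(1) that by (auto simp: G_def z_def)
    have "cball z \<epsilon> \<subseteq> Unp A"
    proof
      fix y assume "y \<in> cball z \<epsilon>"
      then have "dist y a \<le> r" using za dist_triangle[of y a z] by (simp add: \<epsilon>_def dist_commute)
      then show "y \<in> Unp A" using mem_Unp_of_dist_le[OF a] by simp
    qed
    then have cont: "continuous_on (cball z \<epsilon>) proj"
      using continuous_on_closest_point_Unp[OF closed_A nonempty] by auto
    have ne: "z \<noteq> proj y" for y using zb[OF proj_mem[of y]] \<open>0 < \<tau>\<close> by auto
    define F where "F = (\<lambda>y. z + (\<epsilon> / norm (z - proj y)) *\<^sub>R (z - proj y))"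
    have "continuous_on (cball z \<epsilon>) F" unfolding F_def
      using ne by (intro continuous_intros cont) auto
    moreover have "F \<in> cball z \<epsilon> \<rightarrow> cball z \<epsilon>"
      using \<open>0 < \<epsilon>\<close> by (auto simp: F_def dist_norm)
    ultimately obtain y where y: "y \<in> cball z \<epsilon>" "F y = y"
      using brouwer[of "cball z \<epsilon>" F] \<open>0 < \<epsilon>\<close> by auto
    define p where "p = proj y"
    have "z \<noteq> p" using ne by (auto simp: p_def)
    have y': "y - z = (\<epsilon> / norm (z - p)) *\<^sub>R (z - p)"
      using y(2) unfolding F_def p_def by (metis add_diff_cancel_left')
    have "dist y z = \<epsilon>" using y' \<open>0 < \<epsilon>\<close> \<open>z \<noteq> p\<close> by (simp add: dist_norm)
    have "y - p = (1 + \<epsilon> / norm (z - p)) *\<^sub>R (z - p)"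
      using y' by (simp add: algebra_simps)
    then have "dist y p = (1 + \<epsilon> / norm (z - p)) * norm (z - p)"
      using \<open>0 < \<epsilon>\<close> by (simp add: dist_norm)
    then have yp: "dist y p = dist z p + \<epsilon>"
      using \<open>z \<noteq> p\<close> by (simp add: dist_norm distrib_right)
    have yb: "dist y p \<le> dist y b" if "b \<in> A" for b
      using dist_proj[of y] infdist_le[OF that, of y] by (simp add: p_def)
    \<comment> \<open>Since \<open>z\<close> lies between \<open>y\<close> and \<open>p\<close>,
      subtracting \<epsilon> from \<open>dist y p \<le> dist y b\<close> makes \<open>p\<close> a
      nearest point of \<open>z\<close> too. Uniqueness at \<open>z\<close> then identifies it with
      \<open>a\<close>.\<close>
    have "dist z p \<le> dist z b" if "b \<in> A" for b
      using yb[OF that] yp \<open>dist y z = \<epsilon>\<close> dist_triangle[of y b z] by simp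
    moreover have "z \<in> Unp A" using \<open>cball z \<epsilon> \<subseteq> Unp A\<close> \<open>0 < \<epsilon>\<close> by auto
    ultimately have "proj z = p"
      using closest_point_eq_of_Unp[OF closed_A] proj_mem p_def by blast
    moreover have "proj z = a"
      using closest_point_eq_of_Unp[OF closed_A \<open>z \<in> Unp A\<close> a] zb za by auto
    ultimately have "p = a" by simp
    then have "y = a + (\<tau> + \<epsilon>) *\<^sub>R n"
      using y' n \<open>0 < \<tau>\<close> by (simp add: z_def algebra_simps)
    then have "\<tau> + \<epsilon> \<in> G"
      using yb yp za \<open>p = a\<close> \<open>0 < \<tau>\<close> \<open>0 < \<epsilon>\<close> by (auto simp: G_def \<epsilon>_def)
    then show False using \<tau>(2) \<open>0 < \<epsilon>\<close> by fastforce
  qed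
  then show ?thesis using \<tau>(1) b by (auto simp: G_def)
qed

text \<open>The foot point stays nearest along the ray up to length r, so the open ball of radius r
  touching \<open>A\<close> there contains no point of \<open>A\<close>. Expanding the square of the
  distance from its centre to \<open>b\<close> gives the inequality.\<close>

lemma proximal_inequality_proj:
  assumes z: "infdist z A \<le> r" and b: "b \<in> A"
  shows "(z - proj z) \<bullet> (b - proj z) \<le> norm (z - proj z) * (norm (b - proj z))\<^sup>2 / (2 * r)"
proof (cases "z = proj z")
  case True
  then show ?thesis by simp
next
  case False
  define p where "p = proj z"
  define t where "t = norm (z - p)"
  define n where "n = (1 / t) *\<^sub>R (z - p)"
  have "0 < t" using False by (simp add: t_def p_def)
  have zn: "z - p = t *\<^sub>R n" using \<open>0 < t\<close> by (simp add: n_def)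
  have tz: "t = infdist z A" using dist_proj[of z] by (simp add: t_def p_def dist_norm)
  have "norm n = 1" using \<open>0 < t\<close> by (simp add: n_def t_def)
  have "t \<le> dist (p + t *\<^sub>R n) b" if "b \<in> A" for b
    using infdist_le[OF that, of z] tz zn by (metis add_diff_cancel_left' diff_add_cancel add.commute)
  then have "r \<le> dist (p + r *\<^sub>R n) b"
    using normal_ray_extends[of p n t b] proj_mem[of z] \<open>norm n = 1\<close> \<open>0 < t\<close> z tz b by (simp add: p_def)
  then have "r\<^sup>2 \<le> (norm (r *\<^sub>R n - (b - p)))\<^sup>2"
    using r_pos by (intro power_mono) (auto simp: dist_norm algebra_simps)
  also have "\<dots> = r\<^sup>2 - 2 * r * (n \<bullet> (b - p)) + (norm (b - p))\<^sup>2"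
  proof -
    have "(norm (r *\<^sub>R n - (b - p)))\<^sup>2 = (norm (r *\<^sub>R n))\<^sup>2 - 2 * ((r *\<^sub>R n) \<bullet> (b - p)) + (norm (b - p))\<^sup>2"
      unfolding power2_norm_eq_inner by (simp add: inner_diff_left inner_diff_right inner_commute)
    then show ?thesis using \<open>norm n = 1\<close> by simp
  qed
  finally have "n \<bullet> (b - p) \<le> (norm (b - p))\<^sup>2 / (2 * r)"
    using r_pos by (simp add: field_simps)
  then have "t * (n \<bullet> (b - p)) \<le> t * ((norm (b - p))\<^sup>2 / (2 * r))"
    using \<open>0 < t\<close> by (intro mult_left_mono) auto
  moreover have "(z - p) \<bullet> (b - p) = t * (n \<bullet> (b - p))" unfolding zn by simp
  ultimately have "(z - p) \<bullet> (b - p) \<le> norm (z - p) * (norm (b - p))\<^sup>2 / (2 * r)"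
    unfolding t_def[symmetric] by simp
  then show ?thesis by (simp add: p_def)
qed

text \<open>From right to left, the quadratic term vanishes after rescaling along a tangent
  sequence. Conversely, project \<open>a + t n\<close> for small t and write the foot point as
  \<open>a + t v\<close>. A limit l of the v is tangent, so n \<bullet> l \<le> 0, while
  \<open>norm (n - v) \<le> norm n\<close> gives l \<bullet> l \<le> 2 (n \<bullet> l); hence l = 0.
  The vectors \<open>n - v\<close> obey the inequality at the foot points and converge to n.\<close>

lemma Nor_iff_proximal:
  assumes a: "a \<in> A"
  shows "n \<in> Nor A a \<longleftrightarrow> (\<forall>b\<in>A. n \<bullet> (b - a) \<le> norm n * (norm (b - a))\<^sup>2 / (2 * r))"
proof
  assume *: "\<forall>b\<in>A. n \<bullet> (b - a) \<le> norm n * (norm (b - a))\<^sup>2 / (2 * r)"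
  have "n \<bullet> v \<le> 0" if v: "v \<in> Tan A a" for v
  proof (cases "v = 0")
    case False
    then obtain x s where xs: "\<And>i. x i \<in> A \<and> x i \<noteq> a \<and> (0::real) < s i" "x \<longlonglongrightarrow> a"
      "(\<lambda>i. s i *\<^sub>R (x i - a)) \<longlonglongrightarrow> v"
      using v unfolding Tan_def by auto
    have "n \<bullet> v \<le> norm n * (norm v * norm (a - a)) * inverse (2 * r)"
    proof (rule LIMSEQ_le)
      show "(\<lambda>i. n \<bullet> (s i *\<^sub>R (x i - a))) \<longlonglongrightarrow> n \<bullet> v" by (intro tendsto_intros xs)
      show "(\<lambda>i. norm n * (norm (s i *\<^sub>R (x i - a)) * norm (x i - a)) * inverse (2 * r))
          \<longlonglongrightarrow> norm n * (norm v * norm (a - a)) * inverse (2 * r)"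
        by (intro tendsto_intros xs)
      have "n \<bullet> (s i *\<^sub>R (x i - a)) \<le> norm n * (norm (s i *\<^sub>R (x i - a)) * norm (x i - a)) * inverse (2 * r)" for i
      proof -
        have "s i * (n \<bullet> (x i - a)) \<le> s i * (norm n * (norm (x i - a))\<^sup>2 / (2 * r))"
          using * xs(1)[of i] by (intro mult_left_mono) auto
        also have "\<dots> = norm n * ((s i * norm (x i - a)) * norm (x i - a)) * inverse (2 * r)"
          by (simp only: power2_eq_square divide_inverse mult_ac)
        also have "s i * norm (x i - a) = norm (s i *\<^sub>R (x i - a))" using xs(1)[of i] by simp
        finally show ?thesis by simp
      qed
      then show "\<exists>N. \<forall>i\<ge>N. n \<bullet> (s i *\<^sub>R (x i - a)) \<le> norm n * (norm (s i *\<^sub>R (x i - a)) * norm (x i - a)) * inverse (2 * r)"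
        by blast
    qed
    then show ?thesis by simp
  qed simp
  then show "n \<in> Nor A a" by (simp add: Nor_def)
next
  assume n: "n \<in> Nor A a"
  \<comment> \<open>Keeps the displacement \<open>t j * norm n\<close> at most r; the summand 1
    covers n = 0.\<close>
  define t where "t = (\<lambda>j. r / (norm n + 1) * inverse (real (Suc j)))"
  have t_pos: "0 < t j" for j using r_pos by (simp add: t_def add_nonneg_pos)
  have t_lim: "t \<longlonglongrightarrow> 0" unfolding t_def
    by (rule tendsto_mult_right_zero[OF LIMSEQ_inverse_real_of_nat])
  have t_le: "t j * norm n \<le> r" for j
  proof -
    have "t j \<le> r / (norm n + 1)" unfolding t_def using r_pos
      by (intro mult_right_le_one_le) (auto simp: field_simps)
    then have "t j * norm n \<le> r / (norm n + 1) * norm n" by (intro mult_right_mono) auto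
    also have "\<dots> = r * (norm n / (norm n + 1))" by simp
    also have "\<dots> \<le> r" using r_pos
      by (intro mult_right_le_one_le) (auto simp: divide_le_eq_1 add_nonneg_pos)
    finally show ?thesis .
  qed
  define z where "z = (\<lambda>j. a + t j *\<^sub>R n)"
  define p where "p = (\<lambda>j. proj (z j))"
  have zp: "norm (z j - p j) \<le> t j * norm n" for j
  proof -
    have "norm (z j - p j) \<le> dist (z j) a"
      using infdist_le[OF a, of "z j"] dist_proj[of "z j"] unfolding p_def dist_norm by simp
    also have "\<dots> = t j * norm n" using t_pos[of j] by (simp add: z_def dist_norm)
    finally show ?thesis .
  qed
  define v where "v = (\<lambda>j. (1 / t j) *\<^sub>R (p j - a))"
  have pv: "p j = a + t j *\<^sub>R v j" for j using t_pos[of j] by (simp add: v_def)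
  have nv: "norm (n - v j) \<le> norm n" for j
  proof -
    have "z j - p j = t j *\<^sub>R (n - v j)" by (simp add: z_def pv algebra_simps)
    then show ?thesis using zp[of j] t_pos[of j] by simp
  qed
  have "norm (v j) \<le> 2 * norm n" for j
    using nv[of j] norm_triangle_sub[of "v j" n] by (simp add: norm_minus_commute)
  then have "bounded (range v)" by (auto simp: bounded_iff)
  then obtain l \<sigma> where \<sigma>: "strict_mono \<sigma>" "(v \<circ> \<sigma>) \<longlonglongrightarrow> l"
    using bounded_imp_convergent_subsequence by blast
  have "(\<lambda>j. t (\<sigma> j)) \<longlonglongrightarrow> 0" using LIMSEQ_subseq_LIMSEQ[OF t_lim \<sigma>(1)] by (simp add: o_def)
  have v\<sigma>: "(\<lambda>j. v (\<sigma> j)) \<longlonglongrightarrow> l" using \<sigma>(2) by (simp add: o_def)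
  have "(\<lambda>j. a + t (\<sigma> j) *\<^sub>R v (\<sigma> j)) \<longlonglongrightarrow> a + 0 *\<^sub>R l"
    by (intro tendsto_intros v\<sigma> \<open>(\<lambda>j. t (\<sigma> j)) \<longlonglongrightarrow> 0\<close>)
  then have p\<sigma>: "(\<lambda>j. p (\<sigma> j)) \<longlonglongrightarrow> a" by (simp add: pv)
  have "l = 0"
  proof (rule ccontr)
    assume "l \<noteq> 0"
    then obtain N where N: "\<And>j. N \<le> j \<Longrightarrow> v (\<sigma> j) \<noteq> 0"
      using tendsto_imp_eventually_ne[OF v\<sigma>, of 0] by (auto simp: eventually_sequentially)
    have "l \<in> Tan A a" unfolding Tan_def
    proof (intro CollectI disjI2 exI conjI allI)
      fix i show "p (\<sigma> (i + N)) \<in> A" by (simp add: p_def proj_mem)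
      show "p (\<sigma> (i + N)) \<noteq> a" using N[of "i + N"] t_pos[of "\<sigma> (i + N)"] by (simp add: pv)
      show "0 < 1 / t (\<sigma> (i + N))" using t_pos by simp
      show "(\<lambda>i. p (\<sigma> (i + N))) \<longlonglongrightarrow> a" using LIMSEQ_ignore_initial_segment[OF p\<sigma>, of N] .
      show "(\<lambda>i. (1 / t (\<sigma> (i + N))) *\<^sub>R (p (\<sigma> (i + N)) - a)) \<longlonglongrightarrow> l"
        using LIMSEQ_ignore_initial_segment[OF v\<sigma>, of N] by (simp add: v_def)
    qed
    then have "n \<bullet> l \<le> 0" using n by (simp add: Nor_def)
    have "(\<lambda>j. norm (n - v (\<sigma> j))) \<longlonglongrightarrow> norm (n - l)" by (intro tendsto_intros v\<sigma>)
    then have "norm (n - l) \<le> norm n" by (rule LIMSEQ_le_const2) (use nv in auto)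
    then have "(norm (n - l))\<^sup>2 \<le> (norm n)\<^sup>2" by (intro power_mono) auto
    then have "l \<bullet> l \<le> 2 * (n \<bullet> l)"
      by (simp add: power2_norm_eq_inner inner_diff_left inner_diff_right inner_commute)
    then show False using \<open>n \<bullet> l \<le> 0\<close> \<open>l \<noteq> 0\<close> inner_gt_zero_iff[of l] by linarith
  qed
  have "(\<lambda>j. n - v (\<sigma> j)) \<longlonglongrightarrow> n - 0" using v\<sigma> \<open>l = 0\<close> by (intro tendsto_intros) auto
  then have m: "(\<lambda>j. n - v (\<sigma> j)) \<longlonglongrightarrow> n" by simp
  show "\<forall>b\<in>A. n \<bullet> (b - a) \<le> norm n * (norm (b - a))\<^sup>2 / (2 * r)"
  proof
    fix b assume b: "b \<in> A"
    show "n \<bullet> (b - a) \<le> norm n * (norm (b - a))\<^sup>2 / (2 * r)"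
    proof (rule proximal_inequality_limit[OF p\<sigma> m])
      fix j
      define i where "i = \<sigma> j"
      have zi: "z i - p i = t i *\<^sub>R (n - v i)" by (simp add: z_def pv algebra_simps)
      have "infdist (z i) A \<le> r"
        using zp[of i] t_le[of i] dist_proj[of "z i"] by (simp add: p_def dist_norm)
      then have "(z i - p i) \<bullet> (b - p i) \<le> norm (z i - p i) * (norm (b - p i))\<^sup>2 / (2 * r)"
        using proximal_inequality_proj b by (simp add: p_def)
      then have "t i * ((n - v i) \<bullet> (b - p i)) \<le> t i * (norm (n - v i) * (norm (b - p i))\<^sup>2 / (2 * r))"
        using t_pos[of i] unfolding zi by simp
      then show "(n - v (\<sigma> j)) \<bullet> (b - p (\<sigma> j)) \<le> norm (n - v (\<sigma> j)) * (norm (b - p (\<sigma> j)))\<^sup>2 / (2 * r)"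
        unfolding i_def[symmetric] by (rule mult_left_le_imp_le) (rule t_pos)
    qed
  qed
qed

lemma Nor_closed_graph:
  assumes "\<And>j. x j \<in> A" "\<And>j. n j \<in> Nor A (x j)" "x \<longlonglongrightarrow> a" "n \<longlonglongrightarrow> m"
  shows "m \<in> Nor A a"
proof -
  have "a \<in> A" using closed_A assms(1,3) by (auto simp: closed_sequential_limits)
  moreover have "m \<bullet> (b - a) \<le> norm m * (norm (b - a))\<^sup>2 / (2 * r)" if "b \<in> A" for b
    using assms that Nor_iff_proximal by (intro proximal_inequality_limit[OF assms(3,4)]) auto
  ultimately show ?thesis using Nor_iff_proximal by simp
qed

section \<open>Dimension of the tangent cone\<close>

text \<open>Working in the polar of \<open>Nor A a\<close> avoids having to show that the tangent
  cone is convex. If the distance exceeded e t along a sequence, the unit normals at the foot points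
  would converge to a normal at \<open>a\<close> having inner product at least e with a limit
  direction in \<open>K\<close>.\<close>

lemma infdist_along_polar_of_Nor:
  assumes a: "a \<in> A" and K: "compact K" and polar: "\<And>u n. u \<in> K \<Longrightarrow> n \<in> Nor A a \<Longrightarrow> n \<bullet> u \<le> 0"
    and e: "0 < e"
  shows "\<exists>t0>0. \<forall>t u. 0 < t \<and> t \<le> t0 \<and> u \<in> K \<longrightarrow> infdist (a + t *\<^sub>R u) A \<le> e * t"
proof (rule ccontr)
  assume neg: "\<not> ?thesis"
  obtain B where B: "0 < B" "\<And>u. u \<in> K \<Longrightarrow> norm u \<le> B"
    using compact_imp_bounded[OF K] bounded_pos by blast
  define \<tau> where "\<tau> = (\<lambda>j. r / B * inverse (real (Suc j)))"
  have \<tau>_pos: "0 < \<tau> j" for j using r_pos B by (simp add: \<tau>_def)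
  have \<tau>_lim: "\<tau> \<longlonglongrightarrow> 0" unfolding \<tau>_def
    by (rule tendsto_mult_right_zero[OF LIMSEQ_inverse_real_of_nat])
  have \<tau>_le: "\<tau> j * B \<le> r" for j
  proof -
    have "\<tau> j * B = r * inverse (real (Suc j))" using B(1) by (simp add: \<tau>_def)
    also have "\<dots> \<le> r" using r_pos by (intro mult_right_le_one_le) (auto simp: field_simps)
    finally show ?thesis .
  qed
  have "\<exists>t u. 0 < t \<and> t \<le> \<tau> j \<and> u \<in> K \<and> \<not> infdist (a + t *\<^sub>R u) A \<le> e * t" for j
    using neg \<tau>_pos[of j] by blast
  then obtain t u where tu: "\<And>j. 0 < t j \<and> t j \<le> \<tau> j \<and> u j \<in> K \<and> \<not> infdist (a + t j *\<^sub>R u j) A \<le> e * t j"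
    by metis
  define z where "z = (\<lambda>j. a + t j *\<^sub>R u j)"
  define p where "p = (\<lambda>j. proj (z j))"
  define n where "n = (\<lambda>j. (1 / norm (z j - p j)) *\<^sub>R (z j - p j))"
  have big: "e * t j < norm (z j - p j)" for j
    using tu[of j] dist_proj[of "z j"] by (simp add: z_def p_def dist_norm)
  have ne: "0 < norm (z j - p j)" for j using big[of j] tu[of j] e by (meson less_trans mult_pos_pos)
  have nn: "norm (n j) = 1" for j using ne[of j] by (simp add: n_def)
  have za: "norm (z j - a) \<le> t j * B" for j
    using tu[of j] B(2)[of "u j"] by (simp add: z_def)
  have tB: "t j * B \<le> r" for j
    using \<tau>_le[of j] tu[of j] B(1) by (meson less_imp_le mult_right_mono order_trans)
  have zp: "norm (z j - p j) \<le> t j * B" for j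
    using infdist_le[OF a, of "z j"] dist_proj[of "z j"] za[of j] by (simp add: dist_norm p_def)
  have pa: "norm (a - p j) \<le> 2 * (t j * B)" for j
    using norm_triangle_ineq[of "a - z j" "z j - p j"] za[of j] zp[of j] by (simp add: norm_minus_commute)
  have t_lim: "t \<longlonglongrightarrow> 0"
    by (rule tendsto_sandwich[OF _ _ tendsto_const \<tau>_lim]) (use tu in \<open>auto intro!: always_eventually less_imp_le\<close>)
  have p_lim: "p \<longlonglongrightarrow> a"
  proof -
    have "(\<lambda>j. 2 * (t j * B)) \<longlonglongrightarrow> 2 * (0 * B)" by (intro tendsto_intros t_lim)
    then have "(\<lambda>j. 2 * (t j * B)) \<longlonglongrightarrow> 0" by simp
    then have "(\<lambda>j. p j - a) \<longlonglongrightarrow> 0"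
      by (rule Lim_null_comparison[rotated])
        (use pa in \<open>auto intro!: always_eventually simp: norm_minus_commute\<close>)
    then show ?thesis by (rule LIM_zero_cancel)
  qed
  have prox: "n j \<bullet> (b - p j) \<le> norm (n j) * (norm (b - p j))\<^sup>2 / (2 * r)" if "b \<in> A" for b j
  proof -
    have "infdist (z j) A \<le> r"
      using zp[of j] tB[of j] dist_proj[of "z j"] by (simp add: p_def dist_norm)
    then have "(z j - p j) \<bullet> (b - p j) \<le> norm (z j - p j) * (norm (b - p j))\<^sup>2 / (2 * r)"
      using proximal_inequality_proj that by (simp add: p_def)
    moreover have "z j - p j = norm (z j - p j) *\<^sub>R n j" using ne[of j] by (simp add: n_def)
    ultimately have "norm (z j - p j) * (n j \<bullet> (b - p j)) \<le> norm (z j - p j) * ((norm (b - p j))\<^sup>2 / (2 * r))"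
      by (metis inner_scaleR_left times_divide_eq_right)
    then have "n j \<bullet> (b - p j) \<le> (norm (b - p j))\<^sup>2 / (2 * r)"
      by (rule mult_left_le_imp_le) (rule ne)
    then show ?thesis by (simp add: nn)
  qed
  have "bounded (range (\<lambda>j. (u j, n j)))"
  proof (rule bounded_subset)
    show "bounded (K \<times> cball 0 1)" using K by (simp add: bounded_Times compact_imp_bounded)
    have "u j \<in> K" "n j \<in> cball 0 1" for j using tu[of j] nn[of j] by simp_all
    then show "range (\<lambda>j. (u j, n j)) \<subseteq> K \<times> cball 0 1" by blast
  qed
  then obtain l \<sigma> where \<sigma>: "strict_mono \<sigma>" "((\<lambda>j. (u j, n j)) \<circ> \<sigma>) \<longlonglongrightarrow> l"
    using bounded_imp_convergent_subsequence by blast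
  define u' n' where "u' = fst l" and "n' = snd l"
  have u_lim: "(\<lambda>j. u (\<sigma> j)) \<longlonglongrightarrow> u'" and n_lim: "(\<lambda>j. n (\<sigma> j)) \<longlonglongrightarrow> n'"
    using tendsto_fst[OF \<sigma>(2)] tendsto_snd[OF \<sigma>(2)] by (simp_all add: u'_def n'_def o_def)
  have "u' \<in> K"
    by (rule closed_sequentially[OF compact_imp_closed[OF K] _ u_lim]) (use tu in blast)
  have p\<sigma>: "(\<lambda>j. p (\<sigma> j)) \<longlonglongrightarrow> a" using LIMSEQ_subseq_LIMSEQ[OF p_lim \<sigma>(1)] by (simp add: o_def)
  have "n' \<in> Nor A a"
    unfolding Nor_iff_proximal[OF a]
    by (intro ballI proximal_inequality_limit[OF p\<sigma> n_lim] prox)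
  then have "n' \<bullet> u' \<le> 0" using polar \<open>u' \<in> K\<close> by blast
  \<comment> \<open>The residual \<open>z j - p j\<close> is split at \<open>a\<close>: the
    inequality at the foot point, tested with b = a, makes the first piece of order
    \<open>(t j)\<^sup>2\<close>, and only t times \<open>n j \<bullet> u j\<close> can account for
    a residual larger than e t.\<close>
  have "e \<le> 2 * t j * B\<^sup>2 / r + n j \<bullet> u j" for j
  proof -
    have "n j \<bullet> (a - p j) \<le> (norm (a - p j))\<^sup>2 / (2 * r)" using prox[OF a, of j] by (simp add: nn)
    also have "\<dots> \<le> (2 * (t j * B))\<^sup>2 / (2 * r)"
      using pa[of j] r_pos by (intro divide_right_mono power_mono) auto
    finally have 1: "n j \<bullet> (a - p j) \<le> t j * (2 * t j * B\<^sup>2 / r)"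
      by (simp add: power_mult_distrib power2_eq_square mult_ac)
    have "norm (z j - p j) = n j \<bullet> (z j - p j)"
      using ne[of j] by (simp add: n_def dot_square_norm power2_eq_square)
    also have "\<dots> = n j \<bullet> (a - p j) + t j * (n j \<bullet> u j)"
      by (simp add: z_def inner_add_right inner_diff_right)
    finally have "t j * e \<le> t j * (2 * t j * B\<^sup>2 / r + n j \<bullet> u j)"
      using 1 big[of j] by (simp add: distrib_left mult.commute)
    then show ?thesis using tu[of j] by simp
  qed
  then have *: "e \<le> 2 * t (\<sigma> j) * B\<^sup>2 * inverse r + n (\<sigma> j) \<bullet> u (\<sigma> j)" for j
    by (simp add: divide_inverse)
  have "(\<lambda>j. t (\<sigma> j)) \<longlonglongrightarrow> 0" using LIMSEQ_subseq_LIMSEQ[OF t_lim \<sigma>(1)] by (simp add: o_def)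
  then have "(\<lambda>j. 2 * t (\<sigma> j) * B\<^sup>2 * inverse r + n (\<sigma> j) \<bullet> u (\<sigma> j)) \<longlonglongrightarrow> 2 * 0 * B\<^sup>2 * inverse r + n' \<bullet> u'"
    by (intro tendsto_intros u_lim n_lim)
  then have "e \<le> 2 * 0 * B\<^sup>2 * inverse r + n' \<bullet> u'"
    by (rule LIMSEQ_le_const) (use * in auto)
  then show False using \<open>n' \<bullet> u' \<le> 0\<close> e by simp
qed

text \<open>If the polar cone had dimension m > k, the compact image \<open>X\<close> of an
  m-dimensional disc would have unstable values in m coordinates. On the sphere its displacement
  from the centre points outward, so these coordinates are nonzero there and extend over
  \<open>X\<close> without zeros. Pulled back to the disc, this zero-free outward field contradicts
  Brouwer.\<close>

lemma dim_Tan_le: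
  assumes a: "a \<in> A" and dimA: "top_of_set A dim_le int k"
  shows "dim (Tan A a) \<le> k"
proof (rule ccontr)
  assume neg: "\<not> ?thesis"
  \<comment> \<open>The bipolar of the tangent cone: convex by its form, and it contains
    \<open>Tan A a\<close>.\<close>
  define T where "T = {u. \<forall>n\<in>Nor A a. n \<bullet> u \<le> 0}"
  have "Tan A a \<subseteq> T" by (auto simp: T_def Nor_def)
  define m where "m = dim T"
  have "k < m" using neg dim_subset[OF \<open>Tan A a \<subseteq> T\<close>] by (simp add: m_def)
  have "convex T" unfolding T_def convex_def
    by (auto simp: inner_add_right intro!: add_nonpos_nonpos mult_nonneg_nonpos)
  define W where "W = span T"
  have "0 \<in> T" by (simp add: T_def)
  then have aff: "affine hull T = W" unfolding W_def by (simp add: affine_hull_span_0 hull_inc)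
  \<comment> \<open>The disc is centred at a relative interior point of the cone, not at its apex,
    so that all its directions are admissible.\<close>
  have "rel_interior T \<noteq> {}" using \<open>convex T\<close> \<open>0 \<in> T\<close> rel_interior_eq_empty by blast
  then obtain u0 e where e: "0 < e" "cball u0 e \<inter> W \<subseteq> T" and "u0 \<in> T"
    using aff by (auto simp: mem_rel_interior_cball)
  have u0W: "u0 \<in> W" using \<open>u0 \<in> T\<close> by (simp add: W_def span_base)
  have sW: "subspace W" by (simp add: W_def)
  have clW: "closed W" using sW closed_subspace by blast
  have "compact (cball u0 e \<inter> W)" using clW by (simp add: compact_Int_closed)
  moreover have "n \<bullet> u \<le> 0" if "u \<in> cball u0 e \<inter> W" "n \<in> Nor A a" for u n
    using that e(2) unfolding T_def by blast
  \<comment> \<open>The disc will have radius t e; a displacement of a quarter of that cannot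
    reverse the outward direction on its boundary.\<close>
  moreover have "0 < e / 4" using e(1) by simp
  ultimately have "\<exists>t0>0. \<forall>t u. 0 < t \<and> t \<le> t0 \<and> u \<in> cball u0 e \<inter> W \<longrightarrow> infdist (a + t *\<^sub>R u) A \<le> e / 4 * t"
    by (rule infdist_along_polar_of_Nor[OF a])
  then obtain t0 where t0: "0 < t0"
      "\<And>t u. 0 < t \<Longrightarrow> t \<le> t0 \<Longrightarrow> u \<in> cball u0 e \<inter> W \<Longrightarrow> infdist (a + t *\<^sub>R u) A \<le> e / 4 * t"
    by blast
  \<comment> \<open>The bound 4 r / e makes the displacement at most r, so nearest points are unique
    on the disc.\<close>
  define t where "t = min t0 (4 * r / e)"
  have t: "0 < t" "t \<le> t0" using t0 r_pos e by (auto simp: t_def)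
  have "e / 4 * t \<le> r" 
  proof -
    have "e / 4 * t \<le> e / 4 * (4 * r / e)" using e by (intro mult_left_mono) (auto simp: t_def)
    then show ?thesis using e by simp
  qed
  define D where "D = cball 0 1 \<inter> W"
  define c where "c = a + t *\<^sub>R u0"
  define \<psi> where "\<psi> = (\<lambda>w. proj (c + (t * e) *\<^sub>R w))"
  have \<psi>A: "\<psi> w \<in> A" for w by (simp add: \<psi>_def proj_mem)
  have D_inf: "infdist (c + (t * e) *\<^sub>R w) A \<le> e / 4 * t" if "w \<in> D" for w
  proof -
    have "u0 + e *\<^sub>R w \<in> cball u0 e \<inter> W"
      using that u0W sW e(1) by (auto simp: D_def dist_norm subspace_add subspace_scale mult_left_le)
    then show ?thesis using t0(2)[OF t, of "u0 + e *\<^sub>R w"] by (simp add: c_def algebra_simps)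
  qed
  have \<psi>d: "norm (\<psi> w - (c + (t * e) *\<^sub>R w)) \<le> e / 4 * t" if "w \<in> D" for w
    using D_inf[OF that] dist_proj[of "c + (t * e) *\<^sub>R w"] by (simp add: \<psi>_def dist_norm norm_minus_commute)
  have "compact D" using clW by (simp add: D_def compact_Int_closed)
  have "convex D" using sW by (simp add: D_def convex_Int subspace_imp_convex)
  have "0 \<in> D" using sW by (simp add: D_def subspace_0)
  have cont\<psi>: "continuous_on D \<psi>"
  proof -
    have "compact ((\<lambda>w. c + (t * e) *\<^sub>R w) ` D)"
      by (intro compact_continuous_image continuous_intros \<open>compact D\<close>)
    moreover have "(\<lambda>w. c + (t * e) *\<^sub>R w) ` D \<subseteq> Unp A"
      using D_inf \<open>e / 4 * t \<le> r\<close> by (blast intro: mem_Unp order_trans)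
    ultimately have "continuous_on ((\<lambda>w. c + (t * e) *\<^sub>R w) ` D) proj"
      using continuous_on_closest_point_Unp[OF closed_A nonempty] compact_imp_bounded by blast
    moreover have "continuous_on D (\<lambda>w. c + (t * e) *\<^sub>R w)" by (intro continuous_intros)
    ultimately have "continuous_on D (proj \<circ> (\<lambda>w. c + (t * e) *\<^sub>R w))"
      by (intro continuous_on_compose)
    then show ?thesis by (simp add: \<psi>_def o_def)
  qed
  define X where "X = \<psi> ` D"
  define C where "C = \<psi> ` (D \<inter> sphere 0 1)"
  have "compact X" unfolding X_def using cont\<psi> \<open>compact D\<close> compact_continuous_image by blast
  have "compact C" unfolding C_def using cont\<psi> \<open>compact D\<close>
    by (intro compact_continuous_image compact_Int compact_sphere) (auto intro: continuous_on_subset)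
  have "X \<subseteq> A" using \<psi>A by (auto simp: X_def)
  then have "top_of_set X dim_le int k" using dimA dimension_le_subtopologies by blast
  then have "top_of_set X dim_le (int m - 1)" by (rule dimension_le_mono) (use \<open>k < m\<close> in simp)
  then have unst: "unstable_values m X" using dim_le_imp_unstable_values \<open>compact X\<close> by blast
  have "dim W = m" by (simp add: W_def m_def dim_span)
  then obtain B where B: "B \<subseteq> W" "pairwise orthogonal B" "\<And>x. x \<in> B \<Longrightarrow> norm x = 1" "independent B"
      "card B = m" "span B = W"
    using orthonormal_basis_subspace[OF sW] by metis
  have "finite B" using B(4) independent_imp_finite by blast
  then obtain b where b: "bij_betw b {..<m} B"
    using ex_bij_betw_nat_finite[of B] B(5) by (auto simp: lessThan_atLeast0)
  have bB: "b i \<in> B" if "i < m" for i using b that by (auto simp: bij_betw_def)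
  have b_orth: "b i \<bullet> b j = (if i = j then 1 else 0)" if "i < m" "j < m" for i j
  proof (cases "i = j")
    case False
    then have "b i \<noteq> b j" using b that by (auto simp: bij_betw_def inj_on_def)
    then show ?thesis using B(2) bB that False by (auto simp: pairwise_def orthogonal_def)
  next
    case True
    then show ?thesis using B(3) bB that by (simp add: norm_eq_1)
  qed
  have expand: "(\<Sum>i<m. (w \<bullet> b i) *\<^sub>R b i) = w" if "w \<in> W" for w
  proof -
    have "(\<Sum>x\<in>B. (w \<bullet> x) *\<^sub>R x) = w"
      using that B \<open>finite B\<close> by (intro orthonormal_basis_expand) auto
    then show ?thesis using sum.reindex_bij_betw[OF b, of "\<lambda>x. (w \<bullet> x) *\<^sub>R x"] by simp
  qed
  define f where "f = (\<lambda>i x. (x - c) \<bullet> b i)"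
  have pos: "0 < (\<psi> w - c) \<bullet> w" if "w \<in> D" "norm w = 1" for w
  proof -
    have "(\<psi> w - (c + (t * e) *\<^sub>R w)) \<bullet> w \<ge> - (e / 4 * t)"
      using Cauchy_Schwarz_ineq2[of "\<psi> w - (c + (t * e) *\<^sub>R w)" w] \<psi>d[OF that(1)] that(2) by simp
    moreover have "(\<psi> w - c) \<bullet> w = (\<psi> w - (c + (t * e) *\<^sub>R w)) \<bullet> w + t * e"
      using that(2) by (simp add: inner_diff_left inner_add_left dot_square_norm)
    moreover have "0 < t * e" using t e by simp
    ultimately show ?thesis by (simp add: mult.commute)
  qed
  have via: "(\<psi> w - c) \<bullet> w = (\<Sum>i<m. f i (\<psi> w) * (b i \<bullet> w))" if "w \<in> D" for w
  proof -
    have "w \<in> W" using that by (simp add: D_def)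
    then have "(\<psi> w - c) \<bullet> w = (\<psi> w - c) \<bullet> (\<Sum>i<m. (w \<bullet> b i) *\<^sub>R b i)" using expand by simp
    then show ?thesis by (simp add: inner_sum_right f_def mult.commute inner_commute)
  qed
  have "\<exists>i<m. f i x \<noteq> 0" if x: "x \<in> C" for x
  proof (rule ccontr)
    assume *: "\<not> ?thesis"
    obtain w where w: "x = \<psi> w" "w \<in> D" "norm w = 1" using x by (auto simp: C_def)
    then show False using via[OF w(2)] pos[OF w(2,3)] * by simp
  qed
  moreover have "\<forall>i<m. continuous_on UNIV (f i)" by (auto simp: f_def intro!: continuous_intros)
  ultimately obtain g where g: "\<forall>i<m. continuous_on UNIV (g i)" "\<forall>i<m. \<forall>x\<in>C. g i x = f i x"
      "\<forall>x\<in>C \<union> X. \<exists>i<m. g i x \<noteq> 0"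
    using unst[unfolded unstable_values_def, rule_format, of C f] \<open>compact C\<close> by blast
  define G where "G = (\<lambda>w. \<Sum>i<m. g i (\<psi> w) *\<^sub>R b i)"
  have Gb: "G w \<bullet> b j = g j (\<psi> w)" if "j < m" for w j
  proof -
    have "G w \<bullet> b j = (\<Sum>i<m. if i = j then g i (\<psi> w) else 0)"
      unfolding G_def inner_sum_left using b_orth that by (intro sum.cong) auto
    then show ?thesis using that by simp
  qed
  have Gne: "G w \<noteq> 0" if "w \<in> D" for w
  proof -
    have "\<psi> w \<in> C \<union> X" using that by (simp add: X_def)
    then obtain i where "i < m" "g i (\<psi> w) \<noteq> 0" using g(3) by blast
    then show ?thesis using Gb[of i w] by auto
  qed
  have GW: "G w \<in> W" for w
    unfolding G_def using B(1) bB by (intro subspace_sum subspace_scale sW) auto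
  have contG: "continuous_on D G" unfolding G_def
  proof (intro continuous_on_sum continuous_on_scaleR continuous_on_const)
    fix i assume "i \<in> {..<m}"
    then have "continuous_on (\<psi> ` D) (g i)" using g(1) continuous_on_subset by blast
    then show "continuous_on D (\<lambda>w. g i (\<psi> w))"
      using continuous_on_compose[OF cont\<psi>] by (simp add: o_def)
  qed
  \<comment> \<open>A fixed point must have norm 1, where \<open>G\<close> represents the true
    displacement; there the field would point inward, against \<open>pos\<close>.\<close>
  define H where "H = (\<lambda>w. (- 1 / norm (G w)) *\<^sub>R G w)"
  have "continuous_on D H" unfolding H_def
    using Gne by (intro continuous_intros contG) auto
  moreover have "H \<in> D \<rightarrow> D"
  proof
    fix w assume "w \<in> D"
    then have "norm (H w) = 1" using Gne[of w] by (simp add: H_def)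
    moreover have "H w \<in> W" unfolding H_def by (intro subspace_scale sW GW)
    ultimately show "H w \<in> D" by (simp add: D_def)
  qed
  ultimately obtain w where w: "w \<in> D" "H w = w"
    using brouwer[of D H] \<open>compact D\<close> \<open>convex D\<close> \<open>0 \<in> D\<close> by blast
  have "norm (H w) = 1" using Gne[OF w(1)] by (simp add: H_def)
  then have "norm w = 1" using w(2) by simp
  then have "\<psi> w \<in> C" using w by (auto simp: C_def)
  then have "(\<psi> w - c) \<bullet> w = G w \<bullet> w"
    unfolding via[OF w(1)] using g(2) by (simp add: G_def inner_sum_left)
  also have "\<dots> = G w \<bullet> H w" using w by simp
  also have "\<dots> = - norm (G w)" by (simp add: H_def dot_square_norm power2_eq_square)
  also have "\<dots> \<le> 0" by simp
  finally show False using pos[OF w(1) \<open>norm w = 1\<close>] by simp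
qed

end

subsection \<open>Lipschitz DC extensions\<close>

text \<open>Both convex parts are Lipschitz and live on the whole space, so the function is at once
  Lipschitz and DC on any subspace, as a DC surface demands.\<close>

definition lipschitz_dc :: "('a::euclidean_space \<Rightarrow> real) \<Rightarrow> bool" where
  "lipschitz_dc f \<longleftrightarrow> (\<exists>g h L. convex_on UNIV g \<and> convex_on UNIV h \<and> L-lipschitz_on UNIV g \<and>
     L-lipschitz_on UNIV h \<and> (\<forall>x. f x = g x - h x))"

lemma lipschitz_dcI:
  assumes "convex_on UNIV g" "convex_on UNIV h" "L-lipschitz_on UNIV g" "M-lipschitz_on UNIV h"
    "\<And>x. f x = g x - h x"
  shows "lipschitz_dc f"
  unfolding lipschitz_dc_def
proof (intro exI conjI allI)
  show "(max L M)-lipschitz_on UNIV g" "(max L M)-lipschitz_on UNIV h"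
    using lipschitz_on_le[OF assms(3)] lipschitz_on_le[OF assms(4)] by auto
qed (use assms in auto)

lemma lipschitz_dc_add:
  assumes "lipschitz_dc f" "lipschitz_dc g"
  shows "lipschitz_dc (\<lambda>x. f x + g x)"
proof -
  obtain f1 f2 L where f: "convex_on UNIV f1" "convex_on UNIV f2" "L-lipschitz_on UNIV f1"
     "L-lipschitz_on UNIV f2" "\<And>x. f x = f1 x - f2 x"
    using assms(1) unfolding lipschitz_dc_def by blast
  obtain g1 g2 M where g: "convex_on UNIV g1" "convex_on UNIV g2" "M-lipschitz_on UNIV g1"
     "M-lipschitz_on UNIV g2" "\<And>x. g x = g1 x - g2 x"
    using assms(2) unfolding lipschitz_dc_def by blast
  show ?thesis
  proof (rule lipschitz_dcI)
    show "convex_on UNIV (\<lambda>x. f1 x + g1 x)" "convex_on UNIV (\<lambda>x. f2 x + g2 x)"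
      using f g by (auto intro: convex_on_add)
    show "(L + M)-lipschitz_on UNIV (\<lambda>x. f1 x + g1 x)" "(L + M)-lipschitz_on UNIV (\<lambda>x. f2 x + g2 x)"
      using f g by (auto intro: lipschitz_on_add)
    show "f x + g x = (f1 x + g1 x) - (f2 x + g2 x)" for x using f g by simp
  qed
qed

lemma lipschitz_dc_minus:
  assumes "lipschitz_dc f"
  shows "lipschitz_dc (\<lambda>x. - f x)"
proof -
  obtain f1 f2 L where f: "convex_on UNIV f1" "convex_on UNIV f2" "L-lipschitz_on UNIV f1"
     "L-lipschitz_on UNIV f2" "\<And>x. f x = f1 x - f2 x"
    using assms(1) unfolding lipschitz_dc_def by blast
  show ?thesis by (rule lipschitz_dcI[OF f(2,1,4,3)]) (simp add: f)
qed

lemma lipschitz_dc_cmult: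
  assumes "lipschitz_dc f"
  shows "lipschitz_dc (\<lambda>x. c * f x)"
proof -
  have pos: "lipschitz_dc (\<lambda>x. c * f x)" if c: "0 \<le> c" for c
  proof -
    obtain f1 f2 L where f: "convex_on UNIV f1" "convex_on UNIV f2" "L-lipschitz_on UNIV f1"
       "L-lipschitz_on UNIV f2" "\<And>x. f x = f1 x - f2 x"
      using assms(1) unfolding lipschitz_dc_def by blast
    show ?thesis
    proof (rule lipschitz_dcI)
      show "convex_on UNIV (\<lambda>x. c * f1 x)" "convex_on UNIV (\<lambda>x. c * f2 x)"
        using f c by (auto intro: convex_on_cmul)
      show "(c * L)-lipschitz_on UNIV (\<lambda>x. c * f1 x)" "(c * L)-lipschitz_on UNIV (\<lambda>x. c * f2 x)"
        using f c by (auto intro: lipschitz_on_cmult_real_nonneg)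
      show "c * f x = c * f1 x - c * f2 x" for x using f by (simp add: right_diff_distrib)
    qed
  qed
  show ?thesis
  proof (cases "0 \<le> c")
    case True
    then show ?thesis by (rule pos)
  next
    case False
    then show ?thesis using lipschitz_dc_minus[OF pos[of "- c"]] by simp
  qed
qed

lemma lipschitz_dc_0: "lipschitz_dc (\<lambda>x. 0)"
  by (rule lipschitz_dcI[of "\<lambda>_. 0" "\<lambda>_. 0" 0 0]) (auto simp: convex_on_def lipschitz_on_def)

lemma lipschitz_dc_sum:
  assumes "finite I" "\<And>i. i \<in> I \<Longrightarrow> lipschitz_dc (f i)"
  shows "lipschitz_dc (\<lambda>x. \<Sum>i\<in>I. f i x)"
  using assms
  by (induction I rule: finite_induct) (auto intro: lipschitz_dc_0 lipschitz_dc_add)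

lemma lipschitz_dc_imp_dc_on:
  assumes "lipschitz_dc f" "convex W"
  shows "dc_on W f"
proof -
  obtain g h L where f: "convex_on UNIV g" "convex_on UNIV h" "L-lipschitz_on UNIV g"
     "L-lipschitz_on UNIV h" "\<And>x. f x = g x - h x"
    using assms(1) unfolding lipschitz_dc_def by blast
  have "continuous_on W g" "continuous_on W h"
    using f(3,4) by (meson lipschitz_on_continuous_on continuous_on_subset subset_UNIV)+
  moreover have "convex_on W g" "convex_on W h"
    using f(1,2) assms(2) by (auto intro: convex_on_subset)
  ultimately show ?thesis using f(5) unfolding dc_on_def by blast
qed

lemma lipschitz_dc_imp_lipschitz:
  assumes "lipschitz_dc f"
  shows "\<exists>L. L-lipschitz_on UNIV f"
proof -
  obtain g h L where f: "L-lipschitz_on UNIV g" "L-lipschitz_on UNIV h" "\<And>x. f x = g x - h x"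
    using assms(1) unfolding lipschitz_dc_def by blast
  have "(L + L)-lipschitz_on UNIV (\<lambda>x. g x - h x)" using f by (intro lipschitz_on_diff)
  moreover have "f = (\<lambda>x. g x - h x)" using f(3) by auto
  ultimately show ?thesis by auto
qed

lemma lipschitz_on_sum_scaleR:
  fixes m :: "'i \<Rightarrow> 'b::real_normed_vector" and f :: "'i \<Rightarrow> 'a::metric_space \<Rightarrow> real"
  assumes "finite I" "\<And>i. i \<in> I \<Longrightarrow> \<exists>L. L-lipschitz_on S (f i)"
  shows "\<exists>L. L-lipschitz_on S (\<lambda>x. \<Sum>i\<in>I. f i x *\<^sub>R m i)"
  using assms
proof (induction I rule: finite_induct)
  case empty
  then show ?case by (auto intro!: exI[of _ 0] simp: lipschitz_on_def)
next
  case (insert i I)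
  obtain L where L: "L-lipschitz_on S (\<lambda>x. \<Sum>i\<in>I. f i x *\<^sub>R m i)" using insert by auto
  obtain K where K: "K-lipschitz_on S (f i)" using insert by auto
  have "(K * norm (m i))-lipschitz_on S (\<lambda>x. f i x *\<^sub>R m i)"
  proof (rule lipschitz_onI)
    show "0 \<le> K * norm (m i)" using lipschitz_on_nonneg[OF K] by simp
    fix x y assume "x \<in> S" "y \<in> S"
    then have "dist (f i x) (f i y) * norm (m i) \<le> K * dist x y * norm (m i)"
      using lipschitz_onD[OF K] by (intro mult_right_mono) auto
    then show "dist (f i x *\<^sub>R m i) (f i y *\<^sub>R m i) \<le> K * norm (m i) * dist x y"
      by (simp add: dist_norm mult_ac flip: scaleR_left_diff_distrib)
  qed
  from lipschitz_on_add[OF this L] show ?case using insert.hyps by auto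
qed

text \<open>The extension is the supremum of the affine functions with slopes
  \<open>\<eta> w\<close>. The subgradient inequality makes it agree with \<open>h\<close> on
  \<open>S\<close>, which may be any set, and the bound on the slopes makes it finite and
  Lipschitz.\<close>

lemma convex_extension_of_subgradients:
  fixes h :: "'a::euclidean_space \<Rightarrow> real"
  assumes ne: "S \<noteq> {}" and L: "\<And>w. w \<in> S \<Longrightarrow> norm (\<eta> w) \<le> L"
    and sub: "\<And>w v. w \<in> S \<Longrightarrow> v \<in> S \<Longrightarrow> h w + \<eta> w \<bullet> (v - w) \<le> h v"
  obtains H where "convex_on UNIV H" "L-lipschitz_on UNIV H" "\<And>w. w \<in> S \<Longrightarrow> H w = h w"
proof -
  define \<alpha> where "\<alpha> = (\<lambda>x w. h w + \<eta> w \<bullet> (x - w))"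
  define H where "H = (\<lambda>x. SUP w\<in>S. \<alpha> x w)"
  have H_eq: "H x = (SUP w\<in>S. \<alpha> x w)" for x by (simp add: H_def)
  have L0: "0 \<le> L" using ne L by (meson ex_in_conv norm_ge_zero order_trans)
  have step: "\<alpha> x w \<le> \<alpha> y w + L * norm (x - y)" if "w \<in> S" for x y w
  proof -
    have "\<eta> w \<bullet> (x - y) \<le> norm (\<eta> w) * norm (x - y)" by (rule norm_cauchy_schwarz)
    also have "\<dots> \<le> L * norm (x - y)" using L[OF that] by (intro mult_right_mono) auto
    finally show ?thesis by (simp add: \<alpha>_def inner_diff_right)
  qed
  obtain w0 where w0: "w0 \<in> S" using ne by auto
  have bdd: "bdd_above (\<alpha> x ` S)" for x
  proof (rule bdd_aboveI2)
    fix w assume w: "w \<in> S"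
    have "\<alpha> w0 w \<le> h w0" using sub[OF w w0] by (simp add: \<alpha>_def)
    then show "\<alpha> x w \<le> h w0 + L * norm (x - w0)" using step[OF w, of x w0] by simp
  qed
  have upper: "\<alpha> x w \<le> H x" if "w \<in> S" for x w
    unfolding H_eq by (rule cSUP_upper[OF that bdd])
  have lip: "H x \<le> H y + L * norm (x - y)" for x y
    unfolding H_eq[of x]
  proof (rule cSUP_least[OF ne])
    fix w assume w: "w \<in> S"
    show "\<alpha> x w \<le> H y + L * norm (x - y)" using step[OF w, of x y] upper[OF w, of y] by linarith
  qed
  show ?thesis
  proof (rule that)
    show "L-lipschitz_on UNIV H"
    proof (rule lipschitz_onI[OF _ L0])
      fix x y
      show "dist (H x) (H y) \<le> L * dist x y"
        using lip[of x y] lip[of y x] by (simp add: dist_norm norm_minus_commute abs_le_iff)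
    qed
    show "convex_on UNIV H"
    proof (rule convex_onI)
      fix t :: real and x y :: 'a assume t: "0 < t" "t < 1"
      show "H ((1 - t) *\<^sub>R x + t *\<^sub>R y) \<le> (1 - t) * H x + t * H y"
        unfolding H_eq[of "(1 - t) *\<^sub>R x + t *\<^sub>R y"]
      proof (rule cSUP_least[OF ne])
        fix w assume w: "w \<in> S"
        have "\<alpha> ((1 - t) *\<^sub>R x + t *\<^sub>R y) w = (1 - t) * \<alpha> x w + t * \<alpha> y w"
          by (simp add: \<alpha>_def inner_add_right inner_diff_right algebra_simps)
        also have "\<dots> \<le> (1 - t) * H x + t * H y"
          using t upper[OF w] by (intro add_mono mult_left_mono) auto
        finally show "\<alpha> ((1 - t) *\<^sub>R x + t *\<^sub>R y) w \<le> (1 - t) * H x + t * H y" .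
      qed
    qed simp
    show "H w = h w" if w: "w \<in> S" for w
    proof (rule antisym)
      show "H w \<le> h w" unfolding H_eq
        by (rule cSUP_least[OF ne]) (use sub[OF _ w] in \<open>simp add: \<alpha>_def\<close>)
      show "h w \<le> H w" using upper[OF w, of w] by (simp add: \<alpha>_def)
    qed
  qed
qed

text \<open>Write h as \<open>K * (norm w)\<^sup>2\<close> minus the same quadratic minus h. Both
  terms have subgradients on \<open>S\<close>, namely \<open>(2 * K) *\<^sub>R w\<close> and this
  vector minus \<open>\<xi> w\<close>, bounded because \<open>S\<close> is. The quadratic is
  extended anew since it is not globally Lipschitz.\<close>

lemma lipschitz_dc_extension_of_semiconcave:
  fixes h :: "'a::euclidean_space \<Rightarrow> real"
  assumes ne: "S \<noteq> {}" and bd: "bounded S" and K: "0 \<le> K"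
    and M: "\<And>w. w \<in> S \<Longrightarrow> norm (\<xi> w) \<le> M"
    and semi: "\<And>w v. w \<in> S \<Longrightarrow> v \<in> S \<Longrightarrow> h v \<le> h w + \<xi> w \<bullet> (v - w) + K * (norm (v - w))\<^sup>2"
  obtains F where "lipschitz_dc F" "\<And>w. w \<in> S \<Longrightarrow> F w = h w"
proof -
  obtain R where R: "\<And>w. w \<in> S \<Longrightarrow> norm w \<le> R" using bd by (auto simp: bounded_iff)
  have sq: "(norm v)\<^sup>2 = (norm w)\<^sup>2 + 2 * (w \<bullet> (v - w)) + (norm (v - w))\<^sup>2" for v w :: 'a
    unfolding power2_norm_eq_inner by (simp add: inner_diff_left inner_diff_right inner_commute)
  have b1: "norm ((2 * K) *\<^sub>R w) \<le> 2 * K * R" if "w \<in> S" for w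
    using R[OF that] K by (simp add: mult_left_mono)
  have "K * (norm w)\<^sup>2 + (2 * K) *\<^sub>R w \<bullet> (v - w) \<le> K * (norm v)\<^sup>2" for v w :: 'a
    using K by (simp add: sq[of v w] distrib_left)
  with b1 obtain V where V: "convex_on UNIV V" "(2 * K * R)-lipschitz_on UNIV V"
      "\<And>w. w \<in> S \<Longrightarrow> V w = K * (norm w)\<^sup>2"
    using convex_extension_of_subgradients[OF ne, of "\<lambda>w. (2 * K) *\<^sub>R w" "2 * K * R" "\<lambda>w. K * (norm w)\<^sup>2"]
    by blast
  have b2: "norm ((2 * K) *\<^sub>R w - \<xi> w) \<le> 2 * K * R + M" if "w \<in> S" for w
    using norm_triangle_ineq4[of "(2 * K) *\<^sub>R w" "\<xi> w"] b1[OF that] M[OF that] by linarith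
  have s2: "(K * (norm w)\<^sup>2 - h w) + ((2 * K) *\<^sub>R w - \<xi> w) \<bullet> (v - w) \<le> K * (norm v)\<^sup>2 - h v"
    if "w \<in> S" "v \<in> S" for v w
    using semi[OF that] by (simp add: sq[of v w] distrib_left inner_diff_left)
  obtain U where U: "convex_on UNIV U" "(2 * K * R + M)-lipschitz_on UNIV U"
      "\<And>w. w \<in> S \<Longrightarrow> U w = K * (norm w)\<^sup>2 - h w"
    using convex_extension_of_subgradients[OF ne b2 s2] by blast
  show ?thesis
  proof (rule that)
    show "lipschitz_dc (\<lambda>x. V x - U x)" using lipschitz_dcI[OF V(1) U(1) V(2) U(2)] by simp
    show "V w - U w = h w" if "w \<in> S" for w using U V that by simp
  qed
qed

subsection \<open>Orthonormal families and DC graphs\<close>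

text \<open>An indexed family rather than a set, because frames at different points are compared and
  passed to the limit vector by vector.\<close>

locale orthonormal_family =
  fixes m :: "nat \<Rightarrow> 'a::euclidean_space" and q :: nat
  assumes orth: "\<And>i j. i < q \<Longrightarrow> j < q \<Longrightarrow> m i \<bullet> m j = (if i = j then 1 else 0)"
begin

lemma norm_m: "i < q \<Longrightarrow> norm (m i) = 1"
  using orth[of i i] by (simp add: norm_eq_1)

lemma inj_m: "inj_on m {..<q}"
proof (rule inj_onI)
  fix i j assume ij: "i \<in> {..<q}" "j \<in> {..<q}" "m i = m j"
  then have "m i \<bullet> m j = 1" using orth[of i i] by simp
  then show "i = j" using orth[of i j] ij by (auto split: if_splits)
qed

lemma pairwise_orthogonal_m: "pairwise orthogonal (m ` {..<q})"
  using orth by (auto simp: pairwise_def orthogonal_def)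

lemma dim_m: "dim (m ` {..<q}) = q"
proof -
  have "0 \<notin> m ` {..<q}" using norm_m by force
  then have "independent (m ` {..<q})"
    using pairwise_orthogonal_independent[OF pairwise_orthogonal_m] by simp
  then have "dim (m ` {..<q}) = card (m ` {..<q})" by (rule dim_eq_card_independent)
  then show ?thesis using inj_m by (simp add: card_image)
qed

lemma expand:
  assumes "x \<in> span (m ` {..<q})"
  shows "(\<Sum>i<q. (x \<bullet> m i) *\<^sub>R m i) = x"
proof -
  have "(\<Sum>y\<in>m ` {..<q}. (x \<bullet> y) *\<^sub>R y) = x"
    using assms pairwise_orthogonal_m norm_m by (intro orthonormal_basis_expand) auto
  then show ?thesis using inj_m by (simp add: sum.reindex)
qed

definition proj_span :: "'a \<Rightarrow> 'a" where
  "proj_span x = (\<Sum>i<q. (x \<bullet> m i) *\<^sub>R m i)"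

lemma linear_proj_span: "linear proj_span"
  unfolding proj_span_def
  by (intro linearI) (simp_all add: inner_add_left scaleR_left_distrib sum.distrib scaleR_sum_right)

lemma proj_span_mem: "proj_span x \<in> span (m ` {..<q})"
  unfolding proj_span_def by (intro span_sum span_scale span_base) auto

lemma sum_inner_m:
  assumes "j < q"
  shows "(\<Sum>i<q. c i *\<^sub>R m i) \<bullet> m j = c j"
proof -
  have "(\<Sum>i<q. c i *\<^sub>R m i) \<bullet> m j = (\<Sum>i<q. if i = j then c i else 0)"
    unfolding inner_sum_left using orth assms by (intro sum.cong) auto
  then show ?thesis using assms by simp
qed

lemma proj_span_inner: "i < q \<Longrightarrow> proj_span x \<bullet> m i = x \<bullet> m i"
  unfolding proj_span_def by (rule sum_inner_m)

lemma norm_sum_le: "norm (\<Sum>i<q. c i *\<^sub>R m i) \<le> (\<Sum>i<q. \<bar>c i\<bar>)"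
  by (rule order_trans[OF norm_sum]) (auto intro!: sum_mono simp: norm_m)

definition perp :: "'a set" where
  "perp = {x. \<forall>i<q. x \<bullet> m i = 0}"

lemma subspace_perp: "subspace perp"
  unfolding perp_def subspace_def by (auto simp: inner_add_left)

lemma dim_perp: "dim perp + q = DIM('a)"
proof -
  have "perp = {y \<in> UNIV. \<forall>x \<in> span (m ` {..<q}). orthogonal x y}"
  proof (intro equalityI subsetI CollectI conjI ballI)
    fix y x assume y: "y \<in> perp" and x: "x \<in> span (m ` {..<q})"
    have "y \<bullet> x = (\<Sum>i<q. (x \<bullet> m i) * (y \<bullet> m i))"
      using expand[OF x] by (metis (no_types, lifting) inner_scaleR_right inner_sum_right sum.cong)
    also have "\<dots> = 0" using y by (simp add: perp_def)
    finally show "orthogonal x y" by (simp add: orthogonal_def inner_commute)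
  next
    fix y assume "y \<in> {y \<in> UNIV. \<forall>x \<in> span (m ` {..<q}). orthogonal x y}"
    then have "orthogonal (m i) y" if "i < q" for i using that by (simp add: span_base)
    then show "y \<in> perp" by (simp add: perp_def orthogonal_def inner_commute)
  qed simp
  then show ?thesis
    using dim_subspace_orthogonal_to_vectors[OF subspace_span subspace_UNIV, of "m ` {..<q}"]
    by (simp add: dim_m)
qed

lemma diff_proj_span_mem_perp: "x - proj_span x \<in> perp"
  by (simp add: perp_def inner_diff_left proj_span_inner)

lemma perp_inner_proj_span:
  assumes "\<xi> \<in> perp"
  shows "\<xi> \<bullet> proj_span x = 0"
  using assms unfolding proj_span_def perp_def by (simp add: inner_sum_right)

lemma lipschitz_dc_graph_is_dc_surface:
  assumes F: "\<And>i. i < q \<Longrightarrow> lipschitz_dc (F i)" and q: "0 < q" "q \<le> DIM('a)"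
  shows "dc_surface (DIM('a) - q) {w + (\<Sum>i<q. F i w *\<^sub>R m i) |w. w \<in> perp}"
proof -
  define \<phi> where "\<phi> = (\<lambda>w. \<Sum>i<q. F i w *\<^sub>R m i)"
  have dimp: "dim perp = DIM('a) - q" using dim_perp by simp
  show ?thesis
  proof (cases "DIM('a) - q = 0")
    \<comment> \<open>Here q equals the dimension of the space: the graph lies over
      \<open>{0}\<close> and is a singleton, the DC surface of dimension 0.\<close>
    case True
    then have "perp \<subseteq> {0}" using dimp dim_eq_0 by simp
    then have "perp = {0}" using subspace_0[OF subspace_perp] by auto
    then show ?thesis unfolding dc_surface_def using True by auto
  next
    case False
    have "\<phi> \<in> perp \<rightarrow> orthogonal_comp perp"
    proof
      fix w
      have "orthogonal y (\<phi> w)" if "y \<in> perp" for y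
        using that by (simp add: \<phi>_def perp_def orthogonal_def inner_sum_right)
      then show "\<phi> w \<in> orthogonal_comp perp" by (simp add: orthogonal_comp_def)
    qed
    moreover have "\<exists>L. L-lipschitz_on perp \<phi>"
    proof -
      have "\<exists>L. L-lipschitz_on UNIV (F i)" if "i \<in> {..<q}" for i
        using lipschitz_dc_imp_lipschitz[OF F] that by simp
      then obtain L where "L-lipschitz_on UNIV \<phi>"
        unfolding \<phi>_def using lipschitz_on_sum_scaleR[of "{..<q}" UNIV F m] by blast
      then show ?thesis by (meson lipschitz_on_subset subset_UNIV)
    qed
    moreover have "dc_map_on perp \<phi>"
      unfolding dc_map_on_def
    proof (intro allI impI)
      fix l :: "'a \<Rightarrow> real" assume l: "linear l"
      have "l \<circ> \<phi> = (\<lambda>x. \<Sum>i<q. l (m i) * F i x)"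
        by (rule ext) (simp add: \<phi>_def linear_sum[OF l] linear_cmul[OF l] mult.commute)
      moreover have "lipschitz_dc (\<lambda>x. \<Sum>i<q. l (m i) * F i x)"
        using F by (intro lipschitz_dc_sum lipschitz_dc_cmult) auto
      ultimately show "dc_on perp (l \<circ> \<phi>)"
        using lipschitz_dc_imp_dc_on subspace_imp_convex[OF subspace_perp] by metis
    qed
    moreover have "DIM('a) - q < DIM('a)" using q by simp
    ultimately show ?thesis
      unfolding dc_surface_def using False subspace_perp dimp \<phi>_def by auto
  qed
qed

end

subsection \<open>The stratum\<close>

lemma convergent_subsequence_of_finite_family:
  fixes f :: "nat \<Rightarrow> nat \<Rightarrow> 'a::euclidean_space"
  assumes "\<And>i. i < q \<Longrightarrow> bounded (range (\<lambda>j. f j i))"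
  shows "\<exists>\<sigma> g. strict_mono (\<sigma> :: nat \<Rightarrow> nat) \<and> (\<forall>i<q. (\<lambda>j. f (\<sigma> j) i) \<longlonglongrightarrow> g i)"
  using assms
proof (induction q)
  case 0
  then show ?case using strict_mono_id by auto
next
  case (Suc q)
  then obtain \<sigma> :: "nat \<Rightarrow> nat" and g where \<sigma>: "strict_mono \<sigma>" "\<And>i. i < q \<Longrightarrow> (\<lambda>j. f (\<sigma> j) i) \<longlonglongrightarrow> g i"
    by (metis less_SucI)
  have "bounded (range (\<lambda>j. f (\<sigma> j) q))"
    by (rule bounded_subset[OF Suc.prems[of q]]) auto
  then obtain l \<rho> where \<rho>: "strict_mono \<rho>" "((\<lambda>j. f (\<sigma> j) q) \<circ> \<rho>) \<longlonglongrightarrow> l"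
    using bounded_imp_convergent_subsequence by blast
  show ?case
  proof (intro exI conjI allI impI)
    show "strict_mono (\<sigma> \<circ> \<rho>)" using \<sigma>(1) \<rho>(1) by (rule strict_mono_o)
    fix i assume "i < Suc q"
    then consider "i < q" | "i = q" by linarith
    then show "(\<lambda>j. f ((\<sigma> \<circ> \<rho>) j) i) \<longlonglongrightarrow> (g(q := l)) i"
    proof cases
      case 1
      then show ?thesis using LIMSEQ_subseq_LIMSEQ[OF \<sigma>(2)[OF 1] \<rho>(1)] by (simp add: o_def)
    next
      case 2
      then show ?thesis using \<rho>(2) by (simp add: o_def)
    qed
  qed
qed

lemma Nor_add: "x \<in> Nor A a \<Longrightarrow> y \<in> Nor A a \<Longrightarrow> x + y \<in> Nor A a"
  by (auto simp: Nor_def inner_add_left intro: add_nonpos_nonpos)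

lemma Nor_scale: "x \<in> Nor A a \<Longrightarrow> 0 \<le> c \<Longrightarrow> c *\<^sub>R x \<in> Nor A a"
  by (auto simp: Nor_def intro: mult_nonneg_nonpos)

lemma Nor_0: "0 \<in> Nor A a"
  by (simp add: Nor_def)

lemma Nor_sum: "finite I \<Longrightarrow> (\<And>i. i \<in> I \<Longrightarrow> f i \<in> Nor A a) \<Longrightarrow> (\<Sum>i\<in>I. f i) \<in> Nor A a"
  by (induction I rule: finite_induct) (auto intro: Nor_0 Nor_add)

text \<open>A half-space frame spans a half-space of dimension \<open>q\<close> inside the normal cone. Unlike an
  arbitrary cone of full dimension, a half-space cannot degenerate in a limit.\<close>

definition half_space_frame :: "'a::euclidean_space set \<Rightarrow> nat \<Rightarrow> 'a \<Rightarrow> (nat \<Rightarrow> 'a) \<Rightarrow> bool" where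
  "half_space_frame A q a n \<longleftrightarrow> orthonormal_family n q \<and>
     (\<forall>i<q. n i \<in> Nor A a) \<and> (\<forall>i. 0 < i \<and> i < q \<longrightarrow> - n i \<in> Nor A a)"

lemma half_space_frame_imp_dim_Nor:
  assumes "half_space_frame A q a n"
  shows "q \<le> dim (Nor A a)"
proof -
  interpret orthonormal_family n q using assms by (simp add: half_space_frame_def)
  have "n ` {..<q} \<subseteq> Nor A a" using assms by (auto simp: half_space_frame_def)
  then show ?thesis using dim_subset dim_m by metis
qed

text \<open>Vectors orthogonal to \<open>Tan A a\<close> are normal with both signs;
  \<open>U\<close> consists of such vectors and has dimension q - 1. As \<open>Nor A a\<close> has
  dimension at least q, it contains a vector outside \<open>U\<close>, and removing the component in
  \<open>U\<close> keeps it normal. Normalised, it becomes the vector with index 0.\<close>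

lemma half_space_frame_exists:
  fixes A :: "'a::euclidean_space set"
  assumes Tan: "dim (Tan A a) + (q - 1) \<le> DIM('a)" and q: "0 < q" "q \<le> dim (Nor A a)"
  obtains n where "half_space_frame A q a n"
proof -
  define T where "T = {y \<in> UNIV. \<forall>x\<in>span (Tan A a). orthogonal x y}"
  have "dim T + dim (Tan A a) = DIM('a)"
    using dim_subspace_orthogonal_to_vectors[OF subspace_span subspace_UNIV, of "Tan A a"]
    by (simp add: T_def)
  then have "q - 1 \<le> dim T" using Tan by simp
  then obtain U where U: "subspace U" "U \<subseteq> span T" "dim U = q - 1"
    by (rule choose_subspace_of_subspace)
  have "subspace T" unfolding T_def by (auto simp: subspace_def orthogonal_def inner_add_right)
  then have UT: "U \<subseteq> T" using U(2) by (simp add: span_eq_iff[THEN iffD2])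
  have UN: "u \<in> Nor A a" "- u \<in> Nor A a" if "u \<in> U" for u
    using that UT by (auto simp: T_def Nor_def orthogonal_def inner_commute span_base)
  have "\<not> Nor A a \<subseteq> U"
  proof
    assume "Nor A a \<subseteq> U"
    then have "dim (Nor A a) \<le> dim U" by (rule dim_subset)
    then show False using q U(3) by simp
  qed
  then obtain x where x: "x \<in> Nor A a" "x \<notin> U" by blast
  obtain y z where yz: "y \<in> span U" "\<And>w. w \<in> span U \<Longrightarrow> orthogonal z w" "x = y + z"
    using orthogonal_subspace_decomp_exists[of U x] by blast
  have sU: "span U = U" using U(1) by (simp add: span_eq_iff)
  have "z \<noteq> 0" using x(2) yz sU by auto
  have "z = x + - y" using yz by simp
  then have zN: "z \<in> Nor A a" using Nor_add x(1) UN(2) yz(1) sU by metis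
  define n0 where "n0 = (1 / norm z) *\<^sub>R z"
  have n0: "n0 \<in> Nor A a" unfolding n0_def by (intro Nor_scale zN) simp
  have "n0 \<bullet> n0 = 1" using \<open>z \<noteq> 0\<close> by (simp add: n0_def dot_square_norm power2_eq_square)
  have n0U: "n0 \<bullet> w = 0" "w \<bullet> n0 = 0" if "w \<in> U" for w
    using yz(2)[of w] that sU by (simp_all add: n0_def orthogonal_def inner_commute)
  obtain B where B: "B \<subseteq> U" "pairwise orthogonal B" "\<And>x. x \<in> B \<Longrightarrow> norm x = 1" "independent B"
      "card B = dim U"
    using orthonormal_basis_subspace[OF U(1)] by metis
  have "finite B" using B(4) independent_imp_finite by blast
  then obtain b where b: "bij_betw b {..<q - 1} B"
    using ex_bij_betw_nat_finite[of B] B(5) U(3) by (auto simp: lessThan_atLeast0)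
  have bB: "b i \<in> B" if "i < q - 1" for i using b that by (auto simp: bij_betw_def)
  have bb: "b i \<bullet> b j = (if i = j then 1 else 0)" if "i < q - 1" "j < q - 1" for i j
  proof (cases "i = j")
    case False
    then have "b i \<noteq> b j" using b that by (auto simp: bij_betw_def inj_on_def)
    then show ?thesis using B(2) bB that False by (auto simp: pairwise_def orthogonal_def)
  next
    case True
    then show ?thesis using B(3) bB that by (simp add: norm_eq_1)
  qed
  define n where "n = (\<lambda>i. if i = 0 then n0 else b (i - 1))"
  have nU: "n i \<in> U" if "0 < i" "i < q" for i
    using that bB[of "i - 1"] B(1) by (auto simp: n_def)
  have "half_space_frame A q a n"
    unfolding half_space_frame_def
  proof (intro conjI allI impI)
    show "orthonormal_family n q"
    proof
      fix i j assume ij: "i < q" "j < q"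
      show "n i \<bullet> n j = (if i = j then 1 else 0)"
      proof (cases "i = 0 \<or> j = 0")
        case True
        then show ?thesis
          using \<open>n0 \<bullet> n0 = 1\<close> n0U nU[of i] nU[of j] ij by (auto simp: n_def)
      next
        case False
        then show ?thesis using bb[of "i - 1" "j - 1"] ij by (auto simp: n_def)
      qed
    qed
    show "n i \<in> Nor A a" if "i < q" for i
      using n0 UN(1) nU[of i] that by (cases "i = 0") (auto simp: n_def)
    show "- n i \<in> Nor A a" if "0 < i \<and> i < q" for i
      using UN(2) nU[of i] that by auto
  qed
  then show ?thesis by (rule that)
qed

section \<open>Closedness of the stratum and its DC pieces\<close>

context reach_bound
begin

text \<open>With q = d - k + 1 the dimension count needed for a frame reads exactly
  \<open>dim (Tan A a) \<le> k\<close>.\<close>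

lemma half_space_frame_of_stratum:
  assumes dimA: "top_of_set A dim_le int k" and k: "1 \<le> k" "k \<le> DIM('a)"
    and a: "a \<in> stratum A (k - 1)"
  obtains n where "half_space_frame A (DIM('a) - (k - 1)) a n"
proof -
  have "a \<in> A" "DIM('a) - (k - 1) \<le> dim (Nor A a)" using a by (auto simp: stratum_def)
  moreover have "dim (Tan A a) + (DIM('a) - (k - 1) - 1) \<le> DIM('a)"
    using dim_Tan_le[OF \<open>a \<in> A\<close> dimA] k by simp
  moreover have "0 < DIM('a) - (k - 1)" using k by simp
  ultimately show ?thesis using half_space_frame_exists that by blast
qed

lemma closed_stratum:
  assumes dimA: "top_of_set A dim_le int k" and k: "1 \<le> k" "k \<le> DIM('a)"
  shows "closed (stratum A (k - 1))"
  unfolding closed_sequential_limits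
proof (intro allI impI, elim conjE)
  fix x and a :: 'a
  assume x: "\<forall>j. x j \<in> stratum A (k - 1)" and lim: "x \<longlonglongrightarrow> a"
  define q where "q = DIM('a) - (k - 1)"
  have xA: "x j \<in> A" for j using x by (simp add: stratum_def)
  have "\<exists>n. half_space_frame A q (x j) n" for j
    using half_space_frame_of_stratum[OF dimA k, of "x j"] x unfolding q_def by blast
  then obtain n where n: "\<And>j. half_space_frame A q (x j) (n j)" by metis
  have on: "orthonormal_family (n j) q" for j using n by (simp add: half_space_frame_def)
  have "bounded (range (\<lambda>j. n j i))" if "i < q" for i
    using orthonormal_family.norm_m[OF on that] by (auto simp: bounded_iff)
  then obtain \<sigma> m where \<sigma>: "strict_mono \<sigma>" and m: "\<And>i. i < q \<Longrightarrow> (\<lambda>j. n (\<sigma> j) i) \<longlonglongrightarrow> m i"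
    using convergent_subsequence_of_finite_family[of q n] by blast
  have x\<sigma>: "(\<lambda>j. x (\<sigma> j)) \<longlonglongrightarrow> a" using LIMSEQ_subseq_LIMSEQ[OF lim \<sigma>] by (simp add: o_def)
  have "half_space_frame A q a m"
    unfolding half_space_frame_def
  proof (intro conjI allI impI)
    show "orthonormal_family m q"
    proof
      fix i j assume ij: "i < q" "j < q"
      have "(\<lambda>l. n (\<sigma> l) i \<bullet> n (\<sigma> l) j) \<longlonglongrightarrow> m i \<bullet> m j"
        by (intro tendsto_inner m ij)
      then have "(\<lambda>l. if i = j then 1 else 0) \<longlonglongrightarrow> m i \<bullet> m j"
        using orthonormal_family.orth[OF on ij] by simp
      then show "m i \<bullet> m j = (if i = j then 1 else 0)"
        using LIMSEQ_unique tendsto_const by blast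
    qed
    show "m i \<in> Nor A a" if "i < q" for i
      by (rule Nor_closed_graph[OF xA _ x\<sigma> m[OF that]])
        (use n that in \<open>simp add: half_space_frame_def\<close>)
    show "- m i \<in> Nor A a" if "0 < i \<and> i < q" for i
    proof (rule Nor_closed_graph[OF xA _ x\<sigma>])
      show "- n (\<sigma> j) i \<in> Nor A (x (\<sigma> j))" for j using n that by (simp add: half_space_frame_def)
      show "(\<lambda>j. - n (\<sigma> j) i) \<longlonglongrightarrow> - m i" using that by (intro tendsto_minus m) simp
    qed
  qed
  then have "q \<le> dim (Nor A a)" by (rule half_space_frame_imp_dim_Nor)
  moreover have "a \<in> A" by (rule closed_sequentially[OF closed_A _ lim]) (use xA in blast)
  ultimately show "a \<in> stratum A (k - 1)" by (simp add: stratum_def q_def)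
qed

text \<open>The graph is taken over the orthogonal complement of one frame \<open>m\<close> of the
  class. With tolerance 1/(8q) per vector, the errors of all q coordinates add up to at most an
  eighth of the length measured.\<close>

lemma close_frames_in_dc_surface:
  assumes q: "0 < q" "q \<le> DIM('a)" and MA: "M \<subseteq> A" and ne: "M \<noteq> {}"
    and frame: "\<And>b. b \<in> M \<Longrightarrow> half_space_frame A q b (n b)"
    and close_n: "\<And>b c i. b \<in> M \<Longrightarrow> c \<in> M \<Longrightarrow> i < q \<Longrightarrow> norm (n b i - n c i) \<le> 1 / (8 * real q)"
    and close_b: "\<And>b c. b \<in> M \<Longrightarrow> c \<in> M \<Longrightarrow> norm (b - c) \<le> r / (8 * real q)"
  shows "\<exists>S. dc_surface (DIM('a) - q) S \<and> M \<subseteq> S"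
proof -
  obtain b0 where b0: "b0 \<in> M" using ne by blast
  define m where "m = n b0"
  have on: "orthonormal_family (n b) q" if "b \<in> M" for b
    using frame[OF that] by (simp add: half_space_frame_def)
  interpret orthonormal_family m q using on[OF b0] by (simp add: m_def)
  have nm: "\<bar>x \<bullet> n b i - x \<bullet> m i\<bar> \<le> norm x / (8 * real q)" if "b \<in> M" "i < q" for x b i
  proof -
    have "\<bar>x \<bullet> (n b i - m i)\<bar> \<le> norm x * norm (n b i - m i)" by (rule Cauchy_Schwarz_ineq2)
    also have "\<dots> \<le> norm x * (1 / (8 * real q))"
      using close_n[OF that(1) b0 that(2)] by (intro mult_left_mono) (auto simp: m_def)
    finally show ?thesis by (simp add: inner_diff_right)
  qed
  define w where "w = (\<lambda>b. b - proj_span b)"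
  have w_perp: "w b \<in> perp" for b unfolding w_def by (rule diff_proj_span_mem_perp)
  \<comment> \<open>Normality at b bounds the coordinate from above and normality at c from below.
    The quadratic term contributes 1/(16q), the change of frame 1/(8q).\<close>
  have half: "\<bar>(c - b) \<bullet> m i\<bar> \<le> 3 / (16 * real q) * norm (c - b)"
    if bc: "b \<in> M" "c \<in> M" and i: "i < q" for b c i
  proof -
    have one: "(c - b) \<bullet> m i \<le> 3 / (16 * real q) * norm (c - b)" if bc: "b \<in> M" "c \<in> M" for b c
    proof -
      have "n b i \<in> Nor A b" using frame[OF bc(1)] i by (simp add: half_space_frame_def)
      then have "n b i \<bullet> (c - b) \<le> norm (n b i) * (norm (c - b))\<^sup>2 / (2 * r)"
        using Nor_iff_proximal[of b "n b i"] bc MA by blast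
      then have "(c - b) \<bullet> n b i \<le> norm (c - b) * norm (c - b) / (2 * r)"
        using orthonormal_family.norm_m[OF on[OF bc(1)] i] by (simp add: inner_commute power2_eq_square)
      also have "\<dots> \<le> norm (c - b) * (r / (8 * real q)) / (2 * r)"
        using close_b[OF bc(2,1)] r_pos by (intro divide_right_mono mult_left_mono) auto
      also have "\<dots> = 1 / (16 * real q) * norm (c - b)" using r_pos by simp
      finally have "(c - b) \<bullet> m i \<le> 1 / (16 * real q) * norm (c - b) + norm (c - b) / (8 * real q)"
        using nm[OF bc(1) i, of "c - b"] by linarith
      also have "\<dots> = 3 / (16 * real q) * norm (c - b)" using q by (simp add: field_simps)
      finally show ?thesis .
    qed
    have "- ((c - b) \<bullet> m i) = (b - c) \<bullet> m i" by (simp add: inner_diff_left)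
    then show ?thesis using one[OF bc] one[OF bc(2,1)] by (simp add: abs_le_iff norm_minus_commute)
  qed
  \<comment> \<open>The component along the frame is at most 3/16 of the distance, so projecting to
    \<open>perp\<close> shrinks distances at most by the factor 2.\<close>
  have w_expand: "norm (c - b) \<le> 2 * norm (w c - w b)" if bc: "b \<in> M" "c \<in> M" for b c
  proof -
    have "norm (proj_span (c - b)) \<le> (\<Sum>i<q. \<bar>(c - b) \<bullet> m i\<bar>)"
      unfolding proj_span_def by (rule norm_sum_le)
    also have "\<dots> \<le> (\<Sum>i<q. 3 / (16 * real q) * norm (c - b))"
      using half[OF bc] by (intro sum_mono) auto
    also have "\<dots> = 3 / 16 * norm (c - b)" using q by simp
    finally have "norm (proj_span (c - b)) \<le> 3 / 16 * norm (c - b)" .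
    moreover have "c - b = (w c - w b) + proj_span (c - b)"
      by (simp add: w_def linear_diff[OF linear_proj_span])
    then have "norm (c - b) \<le> norm (w c - w b) + norm (proj_span (c - b))"
      by (metis norm_triangle_ineq)
    ultimately show ?thesis using norm_ge_zero[of "c - b"] by linarith
  qed
  have inj: "inj_on w M"
  proof (rule inj_onI)
    fix b c assume "b \<in> M" "c \<in> M" "w b = w c"
    then show "b = c" using w_expand[of b c] by simp
  qed

  \<comment> \<open>An eighth of \<open>norm x\<close> is absorbed on the left, whence 8/7.\<close>
  have norm_le: "norm x \<le> 8 / 7 * (\<Sum>i<q. \<bar>x \<bullet> m i\<bar>)" if b: "b \<in> M" and x: "x \<in> span (n b ` {..<q})" for b x
  proof -
    interpret nb: orthonormal_family "n b" q by (rule on[OF b])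
    have "norm x \<le> (\<Sum>i<q. \<bar>x \<bullet> n b i\<bar>)"
      using nb.norm_sum_le[of "\<lambda>i. x \<bullet> n b i"] nb.expand[OF x] by simp
    also have "\<dots> \<le> (\<Sum>i<q. \<bar>x \<bullet> m i\<bar> + norm x / (8 * real q))"
      using nm[OF b, of _ x] by (intro sum_mono) fastforce
    also have "\<dots> = (\<Sum>i<q. \<bar>x \<bullet> m i\<bar>) + norm x / 8" using q by (simp add: sum.distrib)
    finally show ?thesis by simp
  qed

  text \<open>The orthogonal projection of the half-space spanned by the frame at \<open>b\<close> to the span of \<open>m\<close>
    contains every vector that is far from the boundary hyperplane.\<close>
  have lift: "\<exists>x. x \<in> Nor A b \<and> (\<forall>i<q. x \<bullet> m i = e \<bullet> m i) \<and> norm x \<le> 4"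
    if b: "b \<in> M" and e: "e \<in> span (m ` {..<q})" "e \<bullet> m 0 = 1" "(\<Sum>i<q. \<bar>e \<bullet> m i\<bar>) \<le> 2" for b e
  proof -
    interpret nb: orthonormal_family "n b" q by (rule on[OF b])
    let ?N = "span (n b ` {..<q})"
    \<comment> \<open>\<open>norm_le\<close> excludes a kernel, and both spans have dimension q, so
      the projection is onto.\<close>
    have "inj_on proj_span (span ?N)"
    proof (rule linear_inj_on_iff_eq_0[OF linear_proj_span subspace_span, THEN iffD2], intro ballI impI)
      fix x assume x: "x \<in> span ?N" "proj_span x = 0"
      then have "x \<bullet> m i = 0" if "i < q" for i using proj_span_inner[OF that, of x] by simp
      then show "x = 0" using norm_le[OF b, of x] x by (simp add: span_span)
    qed
    then have "dim (proj_span ` ?N) = dim ?N" by (rule dim_image_eq[OF linear_proj_span])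
    then have "dim (span (m ` {..<q})) \<le> dim (proj_span ` ?N)" using nb.dim_m dim_m by simp
    moreover have "proj_span ` ?N \<subseteq> span (m ` {..<q})" using proj_span_mem by blast
    moreover have "subspace (proj_span ` ?N)"
      by (rule linear_subspace_image[OF linear_proj_span subspace_span])
    ultimately have "proj_span ` ?N = span (m ` {..<q})"
      using subspace_dim_equal[of "proj_span ` ?N" "span (m ` {..<q})"] subspace_span by blast
    then obtain x where x: "x \<in> ?N" "proj_span x = e" using e(1) by (metis image_iff)
    have xm: "x \<bullet> m i = e \<bullet> m i" if "i < q" for i using proj_span_inner[OF that, of x] x(2) by simp
    have nx: "norm x \<le> 4"
    proof -
      have "(\<Sum>i<q. \<bar>x \<bullet> m i\<bar>) = (\<Sum>i<q. \<bar>e \<bullet> m i\<bar>)" using xm by (intro sum.cong) auto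
      then show ?thesis using norm_le[OF b x(1)] e(3) by linarith
    qed
    \<comment> \<open>The coordinate of x along \<open>m 0\<close> is 1 and changes by at most 1/2
      when \<open>n b 0\<close> replaces \<open>m 0\<close>. It remains nonnegative, and only this
      coordinate needs a sign.\<close>
    have "norm x / (8 * real q) \<le> 4 / 8" using nx q by (intro frac_le) auto
    then have pos: "0 \<le> x \<bullet> n b 0" using nm[OF b q(1), of x] xm[OF q(1)] e(2) by linarith
    have "(x \<bullet> n b i) *\<^sub>R n b i \<in> Nor A b" if i: "i < q" for i
    proof (cases "i = 0 \<or> 0 \<le> x \<bullet> n b i")
      case True
      then have "0 \<le> x \<bullet> n b i" using pos by auto
      then show ?thesis using frame[OF b] i by (intro Nor_scale) (auto simp: half_space_frame_def)
    next
      case False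
      then have "(- (x \<bullet> n b i)) *\<^sub>R (- n b i) \<in> Nor A b"
        using frame[OF b] i by (intro Nor_scale) (auto simp: half_space_frame_def)
      then show ?thesis by simp
    qed
    then have "(\<Sum>i<q. (x \<bullet> n b i) *\<^sub>R n b i) \<in> Nor A b" by (intro Nor_sum) auto
    then have "x \<in> Nor A b" using nb.expand[OF x(1)] by simp
    then show ?thesis using xm nx by blast
  qed

  \<comment> \<open>A basis of the span of \<open>m\<close> adapted to \<open>lift\<close>: each
    vector has coordinate 1 along \<open>m 0\<close> and coordinate sum at most 2.\<close>
  define e where "e = (\<lambda>i. if i = 0 then m 0 else m 0 + m i)"
  have em: "e l \<bullet> m i = (if i = 0 \<or> i = l then 1 else 0)" if "l < q" "i < q" for l i
    using that q orth by (auto simp: e_def inner_add_left)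
  have e_span: "e l \<in> span (m ` {..<q})" if "l < q" for l
  proof -
    have "m 0 \<in> span (m ` {..<q})" "m l \<in> span (m ` {..<q})"
      using that q by (auto intro: span_base)
    then show ?thesis by (simp add: e_def span_add)
  qed
  have e_sum: "(\<Sum>i<q. \<bar>e l \<bullet> m i\<bar>) \<le> 2" if l: "l < q" for l
  proof -
    have "(\<Sum>i<q. \<bar>e l \<bullet> m i\<bar>) \<le> (\<Sum>i<q. (if i = 0 then 1 else 0) + (if i = l then 1 else 0))"
      using em[OF l] by (intro sum_mono) auto
    also have "\<dots> \<le> 2" using l q by (simp add: sum.distrib)
    finally show ?thesis .
  qed
  have e_norm: "norm (e l) \<le> 2" if l: "l < q" for l
    using norm_triangle_ineq[of "m 0" "m l"] norm_m[OF l] norm_m[OF q(1)] by (simp add: e_def)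

  have "\<exists>F. lipschitz_dc F \<and> (\<forall>b\<in>M. F (w b) = e l \<bullet> b)" if l: "l < q" for l
  proof -
    have "\<exists>x. x \<in> Nor A b \<and> (\<forall>i<q. x \<bullet> m i = e l \<bullet> m i) \<and> norm x \<le> 4" if "b \<in> M" for b
      by (rule lift[OF that e_span[OF l] _ e_sum[OF l]]) (use em[OF l q(1)] in simp)
    then obtain x where x: "\<And>b. b \<in> M \<Longrightarrow> x b \<in> Nor A b" "\<And>b i. b \<in> M \<Longrightarrow> i < q \<Longrightarrow> x b \<bullet> m i = e l \<bullet> m i"
        "\<And>b. b \<in> M \<Longrightarrow> norm (x b) \<le> 4"
      by metis
    define s where "s = inv_into M w"
    have sw: "s (w b) = b" if "b \<in> M" for b using inj that by (simp add: s_def)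
    \<comment> \<open>The supergradient: \<open>e l\<close> minus a normal with the same
      m-coordinates. It lies in \<open>perp\<close>, so it sees only the projected difference. The
      remainder \<open>x b \<bullet> (c - b)\<close> is at most 4 (2 t)^2 / (2 r) = (8 / r) t^2,
      where t is the projected distance.\<close>
    define \<xi> where "\<xi> = (\<lambda>v. e l - x (s v))"
    have "bounded M"
      unfolding bounded_def using close_b[OF b0] by (auto simp: dist_norm)
    moreover have "linear w"
      unfolding w_def by (rule linear_compose_sub[OF linear_ident linear_proj_span])
    ultimately have "bounded (w ` M)"
      by (intro bounded_linear_image) (simp_all add: linear_conv_bounded_linear)
    moreover have "norm (\<xi> v) \<le> 6" if v: "v \<in> w ` M" for v
    proof -
      obtain b where b: "b \<in> M" "v = w b" using v by blast
      show ?thesis using norm_triangle_ineq4[of "e l" "x b"] e_norm[OF l] x(3)[OF b(1)]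
        by (simp add: \<xi>_def b sw)
    qed
    moreover have "e l \<bullet> s v \<le> e l \<bullet> s u + \<xi> u \<bullet> (v - u) + 8 / r * (norm (v - u))\<^sup>2"
      if uv: "u \<in> w ` M" "v \<in> w ` M" for u v
    proof -
      obtain b c where bc: "b \<in> M" "u = w b" "c \<in> M" "v = w c" using uv by blast
      have \<xi>: "\<xi> u = e l - x b" by (simp add: \<xi>_def bc sw)
      have "\<xi> u \<in> perp" using x(2)[OF bc(1)] by (simp add: \<xi> perp_def inner_diff_left)
      then have "\<xi> u \<bullet> proj_span (c - b) = 0" by (rule perp_inner_proj_span)
      moreover have "v - u = (c - b) - proj_span (c - b)"
        by (simp add: bc w_def linear_diff[OF linear_proj_span])
      ultimately have \<xi>vu: "\<xi> u \<bullet> (v - u) = \<xi> u \<bullet> (c - b)" by (simp add: inner_diff_right)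
      have "x b \<bullet> (c - b) \<le> norm (x b) * (norm (c - b))\<^sup>2 / (2 * r)"
        using Nor_iff_proximal[of b "x b"] x(1)[OF bc(1)] bc MA by blast
      also have "\<dots> \<le> 4 * (2 * norm (v - u))\<^sup>2 / (2 * r)"
        using x(3)[OF bc(1)] w_expand[OF bc(1,3)] r_pos bc
        by (intro divide_right_mono mult_mono power_mono) auto
      also have "\<dots> = 8 / r * (norm (v - u))\<^sup>2" by (simp add: power_mult_distrib)
      finally have "x b \<bullet> (c - b) \<le> 8 / r * (norm (v - u))\<^sup>2" .
      moreover have "e l \<bullet> s v = e l \<bullet> c" "e l \<bullet> s u = e l \<bullet> b" by (simp_all add: bc sw)
      moreover have "\<xi> u \<bullet> (c - b) = e l \<bullet> c - e l \<bullet> b - x b \<bullet> (c - b)"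
        by (simp add: \<xi> inner_diff_left inner_diff_right)
      ultimately show ?thesis using \<xi>vu by linarith
    qed
    moreover have "0 \<le> 8 / r" using r_pos by simp
    moreover have "w ` M \<noteq> {}" using ne by simp
    ultimately obtain F where F: "lipschitz_dc F" "\<And>v. v \<in> w ` M \<Longrightarrow> F v = e l \<bullet> s v"
      using lipschitz_dc_extension_of_semiconcave[of "w ` M" "8 / r" \<xi> 6 "\<lambda>v. e l \<bullet> s v"] by metis
    then show ?thesis using sw by (intro exI[of _ F]) auto
  qed
  then obtain F where F: "\<And>l. l < q \<Longrightarrow> lipschitz_dc (F l)" "\<And>l b. l < q \<Longrightarrow> b \<in> M \<Longrightarrow> F l (w b) = e l \<bullet> b"
    by metis
  \<comment> \<open>For l > 0 this undoes the shift by \<open>m 0\<close> in \<open>e l\<close>; for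
    l = 0 nothing is subtracted.\<close>
  define G where "G = (\<lambda>l v. F l v + (if l = 0 then 0 else - 1) * F 0 v)"
  have G: "lipschitz_dc (G l)" if "l < q" for l
    unfolding G_def by (intro lipschitz_dc_add lipschitz_dc_cmult F(1) that q)
  have Gw: "G l (w b) = b \<bullet> m l" if "l < q" "b \<in> M" for l b
    using F(2)[OF that] F(2)[OF q(1) that(2)]
    by (cases "l = 0") (simp_all add: G_def e_def inner_commute[of _ b] inner_add_right)
  have "M \<subseteq> {v + (\<Sum>i<q. G i v *\<^sub>R m i) |v. v \<in> perp}"
  proof
    fix b assume b: "b \<in> M"
    have "(\<Sum>i<q. G i (w b) *\<^sub>R m i) = proj_span b"
      unfolding proj_span_def using Gw b by (intro sum.cong) auto
    then have "b = w b + (\<Sum>i<q. G i (w b) *\<^sub>R m i)" by (simp add: w_def)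
    then show "b \<in> {v + (\<Sum>i<q. G i v *\<^sub>R m i) |v. v \<in> perp}" using w_perp by blast
  qed
  moreover have "dc_surface (DIM('a) - q) {v + (\<Sum>i<q. G i v *\<^sub>R m i) |v. v \<in> perp}"
    by (rule lipschitz_dc_graph_is_dc_surface[OF G q])
  ultimately show ?thesis by blast
qed

end

section \<open>A uniform bound on the number of surfaces\<close>

text \<open>The net is fixed before A, r and a. A class is labelled by q net points for the frame
  and one for (b - a)/r, so N is the power q + 1 of the size of the net. Points with a common label
  differ by at most 2 \<delta> = 1/(8q).\<close>

lemma stratum_covering_number:
  assumes k: "1 \<le> k" "k \<le> DIM('a::euclidean_space)"
  obtains N :: nat where "\<And>(A :: 'a set) r a. reach_bound A r \<Longrightarrow> top_of_set A dim_le int k \<Longrightarrow>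
    \<exists>\<S>. finite \<S> \<and> card \<S> \<le> N \<and> (\<forall>S\<in>\<S>. dc_surface (k - 1) S) \<and> stratum A (k - 1) \<inter> ball a (r / 2) \<subseteq> \<Union>\<S>"
proof -
  define q where "q = DIM('a) - (k - 1)"
  have q: "0 < q" "q \<le> DIM('a)" "DIM('a) - q = k - 1" using k by (auto simp: q_def)
  define \<delta> where "\<delta> = 1 / (16 * real q)"
  have "0 < \<delta>" using q by (simp add: \<delta>_def)
  obtain E where E: "finite E" "cball (0::'a) 1 \<subseteq> (\<Union>x\<in>E. ball x \<delta>)"
    using compact_cball[of "0::'a" 1] \<open>0 < \<delta>\<close> unfolding compact_eq_totally_bounded by blast
  define I where "I = PiE {..<q} (\<lambda>_. E) \<times> E"
  have finI: "finite I" using E by (simp add: I_def finite_PiE)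
  show ?thesis
  proof (rule that[of "card I"])
    fix A :: "'a set" and r a
    assume "reach_bound A r" and dimA: "top_of_set A dim_le int k"
    then interpret reach_bound A r by simp
    define M where "M = stratum A (k - 1) \<inter> ball a (r / 2)"
    have "\<exists>n. half_space_frame A q b n" if "b \<in> M" for b
      using half_space_frame_of_stratum[OF dimA k, of b] that unfolding q_def M_def by blast
    then obtain n where n: "\<And>b. b \<in> M \<Longrightarrow> half_space_frame A q b (n b)" by metis
    have near: "\<exists>x\<in>E. norm (v - x) < \<delta>" if "norm v \<le> 1" for v
    proof -
      have "v \<in> cball 0 1" using that by simp
      then obtain x where "x \<in> E" "v \<in> ball x \<delta>" using E(2) by blast
      then show ?thesis by (auto simp: dist_norm norm_minus_commute)
    qed
    have "\<exists>x\<in>E. norm (n b i - x) < \<delta>" if "b \<in> M" "i < q" for b i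
      using near orthonormal_family.norm_m[of "n b" q i] n[OF that(1)] that(2)
      by (simp add: half_space_frame_def)
    then obtain \<nu> where \<nu>: "\<And>b i. b \<in> M \<Longrightarrow> i < q \<Longrightarrow> \<nu> b i \<in> E \<and> norm (n b i - \<nu> b i) < \<delta>"
      by metis
    have "\<exists>x\<in>E. norm ((1 / r) *\<^sub>R (b - a) - x) < \<delta>" if "b \<in> M" for b
    proof (rule near)
      have "norm (b - a) < r / 2" using that by (simp add: M_def dist_norm norm_minus_commute)
      then show "norm ((1 / r) *\<^sub>R (b - a)) \<le> 1" using r_pos by simp
    qed
    then obtain \<beta> where \<beta>: "\<And>b. b \<in> M \<Longrightarrow> \<beta> b \<in> E \<and> norm ((1 / r) *\<^sub>R (b - a) - \<beta> b) < \<delta>"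
      by metis
    \<comment> \<open>The restriction to indices below q makes the label extensional, hence a member
      of the finite product.\<close>
    define cls where "cls = (\<lambda>b. (restrict (\<nu> b) {..<q}, \<beta> b))"
    have clsI: "cls b \<in> I" if "b \<in> M" for b
      using \<nu>[OF that] \<beta>[OF that] by (auto simp: cls_def I_def)
    have "\<exists>S. dc_surface (k - 1) S \<and> {b \<in> M. cls b = cls c} \<subseteq> S" if c: "c \<in> M" for c
    proof -
      let ?M = "{b \<in> M. cls b = cls c}"
      have "\<exists>S. dc_surface (DIM('a) - q) S \<and> ?M \<subseteq> S"
      proof (rule close_frames_in_dc_surface[OF q(1,2), where n = n])
        show "?M \<subseteq> A" by (auto simp: M_def stratum_def)
        show "?M \<noteq> {}" using c by blast
        show "half_space_frame A q b (n b)" if "b \<in> ?M" for b using n that by simp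
        show "norm (n b i - n b' i) \<le> 1 / (8 * real q)" if b: "b \<in> ?M" "b' \<in> ?M" and i: "i < q" for b b' i
        proof -
          have "restrict (\<nu> b) {..<q} i = restrict (\<nu> b') {..<q} i" using b by (simp add: cls_def)
          then have "\<nu> b i = \<nu> b' i" using i by simp
          then have "norm (n b i - n b' i) \<le> norm (n b i - \<nu> b i) + norm (n b' i - \<nu> b' i)"
            using norm_triangle_ineq4[of "n b i - \<nu> b i" "n b' i - \<nu> b' i"] by simp
          also have "\<dots> \<le> \<delta> + \<delta>" using \<nu>[of b i] \<nu>[of b' i] b i by simp
          finally show ?thesis by (simp add: \<delta>_def)
        qed
        show "norm (b - b') \<le> r / (8 * real q)" if b: "b \<in> ?M" "b' \<in> ?M" for b b'
        proof -
          have \<beta>eq: "\<beta> b = \<beta> b'" using b by (simp add: cls_def)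
          have "(1 / r) *\<^sub>R (b - b') = ((1 / r) *\<^sub>R (b - a) - \<beta> b) - ((1 / r) *\<^sub>R (b' - a) - \<beta> b')"
            unfolding \<beta>eq by (simp add: scaleR_diff_right)
          then have "norm ((1 / r) *\<^sub>R (b - b')) \<le> norm ((1 / r) *\<^sub>R (b - a) - \<beta> b) + norm ((1 / r) *\<^sub>R (b' - a) - \<beta> b')"
            by (metis norm_triangle_ineq4)
          also have "\<dots> \<le> \<delta> + \<delta>" using \<beta>[of b] \<beta>[of b'] b by simp
          finally have "norm (b - b') / r \<le> 1 / (8 * real q)" using r_pos by (simp add: \<delta>_def)
          then show ?thesis using r_pos by (simp add: field_simps)
        qed
      qed
      then show ?thesis using q(3) by simp
    qed
    then have "\<forall>i\<in>cls ` M. \<exists>S. dc_surface (k - 1) S \<and> {b \<in> M. cls b = i} \<subseteq> S" by blast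
    then obtain T where T: "\<And>i. i \<in> cls ` M \<Longrightarrow> dc_surface (k - 1) (T i) \<and> {b \<in> M. cls b = i} \<subseteq> T i"
      by metis
    have sub: "cls ` M \<subseteq> I" using clsI by blast
    show "\<exists>\<S>. finite \<S> \<and> card \<S> \<le> card I \<and> (\<forall>S\<in>\<S>. dc_surface (k - 1) S) \<and>
        stratum A (k - 1) \<inter> ball a (r / 2) \<subseteq> \<Union>\<S>"
    proof (intro exI conjI ballI)
      have fin: "finite (cls ` M)" by (rule finite_subset[OF sub finI])
      then show "finite (T ` cls ` M)" by (rule finite_imageI)
      show "card (T ` cls ` M) \<le> card I"
        using card_image_le[OF fin, of T] card_mono[OF finI sub] by linarith
      show "dc_surface (k - 1) S" if "S \<in> T ` cls ` M" for S using T that by blast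
      show "stratum A (k - 1) \<inter> ball a (r / 2) \<subseteq> \<Union>(T ` cls ` M)"
        unfolding M_def[symmetric] using T by blast
    qed
  qed
qed

theorem proposition5p8:
  fixes k :: nat
  assumes "1 \<le> k"
  shows "\<exists>N::nat. \<forall>A :: (real ^ 'n) set.
    positive_reach A \<and> has_topological_dim A (int k) \<longrightarrow>
      closed (stratum A (k - 1)) \<and>
      locally_finitely_covered (dc_surface (k - 1)) A (stratum A (k - 1)) \<and>
      (1 < k \<longrightarrow>
        (\<forall>r a. 0 < r \<and> ereal r < reach A \<and> a \<in> A \<longrightarrow>
          (\<exists>\<S>. finite \<S> \<and> card \<S> \<le> N \<and> (\<forall>S\<in>\<S>. dc_surface (k - 1) S) \<and>
               stratum A (k - 1) \<inter> ball a (r / 2) \<subseteq> \<Union>\<S>)))"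
proof (cases "k \<le> DIM(real ^ 'n)")
  case False
  \<comment> \<open>For k > d no subset has dimension k, so the claim is vacuous.\<close>
  have "\<not> has_topological_dim A (int k)" for A :: "(real ^ 'n) set"
  proof -
    have "top_of_set A dim_le (int k - 1)"
      by (rule dimension_le_mono[OF dim_le_DIM]) (use False in linarith)
    then show ?thesis by (simp add: has_topological_dim_def)
  qed
  then show ?thesis by blast
next
  case True
  obtain N :: nat where N: "\<And>(A :: (real ^ 'n) set) r a. reach_bound A r \<Longrightarrow> top_of_set A dim_le int k \<Longrightarrow>
    \<exists>\<S>. finite \<S> \<and> card \<S> \<le> N \<and> (\<forall>S\<in>\<S>. dc_surface (k - 1) S) \<and> stratum A (k - 1) \<inter> ball a (r / 2) \<subseteq> \<Union>\<S>"
    using stratum_covering_number[OF assms True] by blast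
  show ?thesis
  proof (intro exI[of _ N] allI impI, elim conjE)
    fix A :: "(real ^ 'n) set"
    assume A: "positive_reach A" and "has_topological_dim A (int k)"
    then have dimA: "top_of_set A dim_le int k" by (simp add: has_topological_dim_def)
    have rb: "reach_bound A r" if "0 < r" "ereal r < reach A" for r
      using A that by (simp add: reach_bound_def positive_reach_def)
    \<comment> \<open>\<open>reach A\<close> may be infinite, for instance for a closed convex set,
      so a finite radius below it is chosen.\<close>
    obtain r where r: "0 < r" "ereal r < reach A"
      using ereal_dense2[of 0 "reach A"] A by (auto simp: positive_reach_def zero_ereal_def)
    have "closed (stratum A (k - 1))"
      by (rule reach_bound.closed_stratum[OF rb[OF r] dimA assms True])
    moreover have "locally_finitely_covered (dc_surface (k - 1)) A (stratum A (k - 1))"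
      unfolding locally_finitely_covered_def
    proof (rule ballI, rule exI, intro conjI)
      fix a assume "a \<in> A"
      show "open (ball a (r / 2))" by (rule open_ball)
      show "a \<in> ball a (r / 2)" using r by simp
      show "\<exists>\<S>. finite \<S> \<and> (\<forall>S\<in>\<S>. dc_surface (k - 1) S) \<and> stratum A (k - 1) \<inter> ball a (r / 2) \<subseteq> \<Union>\<S>"
        using N[OF rb[OF r] dimA, of a] by blast
    qed
    ultimately show "closed (stratum A (k - 1)) \<and>
      locally_finitely_covered (dc_surface (k - 1)) A (stratum A (k - 1)) \<and>
      (1 < k \<longrightarrow>
        (\<forall>r a. 0 < r \<and> ereal r < reach A \<and> a \<in> A \<longrightarrow>
          (\<exists>\<S>. finite \<S> \<and> card \<S> \<le> N \<and> (\<forall>S\<in>\<S>. dc_surface (k - 1) S) \<and>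
               stratum A (k - 1) \<inter> ball a (r / 2) \<subseteq> \<Union>\<S>)))"
      using N[OF rb dimA] by blast
  qed
qed

end
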